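(* The following inequalities hold: $\sigma(4)\ge\sqrt{8/7}>1.069$, $\sigma(6)\ge\sqrt{16/15}>1.032$, $\sigma(8)\ge\sqrt{8/7}>1.069$, $\sigma(10)\ge\sqrt{49/45}>1.043$, $\sigma(12)\ge\sqrt{6/5}>1.095$, $\sigma(14)\ge\sqrt{121/105}>1.073$, $\sigma(16)\ge\sqrt{289/240}>1.097$, $\sigma(18)\ge\sqrt{32/27}>1.088$, $\sigma(20)\ge\sqrt{40/33}>1.100$, $\sigma(22)\ge\sqrt{324/275}>1.085$.
   Context: $[n]=\{1,2,\dots,n\}$. For a finite set $S\subseteq\mathbb{Z}$ and $k\in\mathbb{Z}$, let $S\ast S(k)=|\{(s_1,s_2): s_1,s_2\in S,\ s_1+s_2=k\}|$ (ordered pairs), and let $\|S\ast S\|_\infty=\max_{k\in\mathbb{Z}} S\ast S(k)$. For positive integers $g,n$, define $R(g,n)=\max\{|S| : S\subseteq[n],\ \|S\ast S\|_\infty\le g\}$. For $g\ge2$ define $\sigma(g)=\liminf_{n\to\infty}\dfrac{R(g,n)}{\sqrt{\lfloor g/2\rfloor\, n}}$. *)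

theory Defs
  imports "HOL-Analysis.Analysis"
begin

definition self_conv :: "int set \<Rightarrow> int \<Rightarrow> nat" where
  "self_conv S k = card {(s1, s2). s1 \<in> S \<and> s2 \<in> S \<and> s1 + s2 = k}"

definition self_conv_norm :: "int set \<Rightarrow> nat" where
  "self_conv_norm S = Max (range (self_conv S))"

definition R_max :: "nat \<Rightarrow> nat \<Rightarrow> nat" where
  "R_max g n = Max {card S |S. S \<subseteq> {1..int n} \<and> self_conv_norm S \<le> g}"

text \<open>The lower limit is taken in the extended reals, so its existence needs no
  boundedness argument. The term at \<open>n = 0\<close> is irrelevant.\<close>

definition sidon_sigma :: "nat \<Rightarrow> ereal" where
  "sidon_sigma g =
     liminf (\<lambda>n. ereal (real (R_max g n) / sqrt (real (g div 2) * real n)))"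

text \<open>Both maxima above are taken over finite nonempty sets, hence are attained.\<close>

lemma finite_range_self_conv:
  assumes "finite S"
  shows "finite (range (self_conv S))"
proof (rule finite_subset)
  have "self_conv S k \<le> card (S \<times> S)" for k
    unfolding self_conv_def using assms by (intro card_mono) auto
  then show "range (self_conv S) \<subseteq> {..card (S \<times> S)}"
    by blast
qed simp

lemma self_conv_norm_empty: "self_conv_norm {} = 0"
  by (simp add: self_conv_norm_def self_conv_def)

lemma R_max_set:
  "finite {card S |S. S \<subseteq> {1..int n} \<and> self_conv_norm S \<le> g}"
  "{card S |S. S \<subseteq> {1..int n} \<and> self_conv_norm S \<le> g} \<noteq> {}"
proof -
  show "finite {card S |S. S \<subseteq> {1..int n} \<and> self_conv_norm S \<le> g}"
    by (rule finite_subset[of _ "card ` Pow {1..int n}"]) auto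
  show "{card S |S. S \<subseteq> {1..int n} \<and> self_conv_norm S \<le> g} \<noteq> {}"
    using self_conv_norm_empty by (auto intro!: exI[of _ "{}"])
qed

end

theory Submission
  imports Defs "HOL-Complex_Analysis.Complex_Analysis" "HOL-Number_Theory.Number_Theory"
    "HOL-Real_Asymp.Real_Asymp"
begin

text \<open>The lower bounds come from interleaving. Let \<open>S\<close> be a Sidon set modulo \<open>m\<close> with about
\<open>sqrt m\<close> elements, and let \<open>A \<subseteq> {0, ..., N - 1}\<close> be a set in which every integer has at most \<open>h\<close>
ordered representations as a sum of two elements. Then the integers \<open>s + m * a\<close> with \<open>s \<in> S\<close> and
\<open>a \<in> A\<close> have at most \<open>2 * h\<close> representations for each sum (\<open>interleave_bound\<close>), lie in an interval of
length \<open>m * N\<close>, and number about \<open>card A * sqrt m\<close>. This yields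
\<open>\<sigma>(2 * h) \<ge> card A / sqrt (h * N)\<close> (\<open>sidon_sigma_ge\<close>), and ten explicit sets \<open>A\<close> give the ten bounds.

The modular Sidon sets are Ruzsa's (\<open>ruzsa_sidon\<close>): modulus \<open>p * (p - 1)\<close> and \<open>p - 1\<close> elements, for each
prime \<open>p\<close>. As the lower limit runs over all \<open>n\<close>, moduli of every approximate size are needed, that
is, a prime between \<open>(1 - \<epsilon>) * x\<close> and \<open>x\<close> for all large \<open>x\<close> (\<open>prime_just_below\<close>). This consequence of the
prime number theorem is proved by a Wiener-Ikehara argument. The function \<open>\<zeta>\<close> is continued to
\<open>Re s > 0\<close>, and it has no zeros with \<open>Re s \<ge> 1\<close> (\<open>zeta_reg_nonzero\<close>), so the Dirichlet series with
coefficients \<open>\<Lambda>(n) - 1\<close> extends holomorphically across \<open>Re s = 1\<close>. Smoothing with a Fejer kernel, whose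
Fourier transform has compact support, and integrating by parts shows that the weights \<open>\<Lambda>(n) / n\<close> and
\<open>1 / n\<close> have asymptotically equal means around \<open>ln n = y\<close> (\<open>smoothed_difference_bound\<close>). On the scale \<open>1\<close>
this gives a Chebyshev bound for the mass of \<open>\<Lambda>(n) / n\<close> (\<open>unit_mass_mangoldt\<close>). On a small scale \<open>1 / l\<close> the
mean of \<open>1 / n\<close> is of order \<open>1 / l\<close>, whereas an interval free of primes would, by the Chebyshev bound,
leave only the tails of the kernel, of order \<open>1 / l\<^sup>2\<close>, and a negligible contribution of proper prime
powers (\<open>prime_in_log_window\<close>).\<close>

section \<open>Modular Sidon sets and interleaving\<close>

text \<open>A modular Sidon set: a set of residues, represented in \<open>{0, ..., m - 1}\<close>, in which a sum modulo
\<open>m\<close> determines the unordered pair of its summands.\<close>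

definition modular_sidon :: "nat \<Rightarrow> nat set \<Rightarrow> bool" where
  "modular_sidon m S \<longleftrightarrow> S \<subseteq> {..<m} \<and>
     (\<forall>a\<in>S. \<forall>b\<in>S. \<forall>c\<in>S. \<forall>d\<in>S. [a + b = c + d] (mod m) \<longrightarrow> (a = c \<and> b = d) \<or> (a = d \<and> b = c))"

text \<open>Modulo a prime, two pairs with the same sum and the same product consist of the roots of one and
the same quadratic polynomial.\<close>

lemma cong_if_same_sum_and_product:
  fixes a b c d :: int
  assumes "prime p" "[a + b = c + d] (mod p)" "[a * b = c * d] (mod p)"
  shows "[a = c] (mod p) \<or> [a = d] (mod p)"
proof -
  have d: "p dvd (a + b) - (c + d)" "p dvd a * b - c * d"
    using assms(2,3) by (simp_all add: cong_iff_dvd_diff)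
  have "p dvd a * ((a + b) - (c + d)) - (a * b - c * d)" by (rule dvd_diff[OF dvd_mult[OF d(1)] d(2)])
  also have "a * ((a + b) - (c + d)) - (a * b - c * d) = (a - c) * (a - d)" by (simp add: algebra_simps)
  finally show ?thesis using assms(1) by (simp add: prime_dvd_mult_iff cong_iff_dvd_diff)
qed

text \<open>Ruzsa's construction. With \<open>g\<close> a primitive root modulo \<open>p\<close>, the set consists of the residues
that are \<open>i\<close> modulo \<open>p - 1\<close> and \<open>g ^ i\<close> modulo \<open>p\<close>. A sum of two of them gives \<open>i + j\<close> modulo
\<open>p - 1\<close>, hence the product \<open>g ^ i * g ^ j\<close> modulo \<open>p\<close>, together with the sum \<open>g ^ i + g ^ j\<close>.\<close>

lemma ruzsa_sidon:
  assumes "prime p"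
  shows "\<exists>S. modular_sidon (p * (p - 1)) S \<and> card S = p - 1"
proof -
  have p: "p \<ge> 2" using assms by (rule prime_ge_2_nat)
  obtain g where g: "residue_primroot p g" using prime_primitive_root_exists[OF _ assms] p by auto
  hence g': "coprime p g" "ord p g = p - 1" using assms by (auto simp: residue_primroot_def totient_prime)
  have cop: "coprime p (p - 1)" using p coprime_diff_one_left_nat[of p] by (simp add: coprime_commute)
  have "\<exists>x. x < p * (p - 1) \<and> [x = g ^ i] (mod p) \<and> [x = i] (mod (p - 1))" for i
    using binary_chinese_remainder_unique_nat[OF cop, of "g ^ i" i] p by auto
  then obtain f where f: "\<And>i. f i < p * (p - 1)" "\<And>i. [f i = g ^ i] (mod p)" "\<And>i. [f i = i] (mod (p - 1))"
    by metis
  define S where "S = f ` {..<p - 1}"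
  have eqD: "i = j" if "[i = j] (mod (p - 1))" "i < p - 1" "j < p - 1" for i j
    using that by (rule cong_less_modulus_unique_nat)
  have "inj_on f {..<p - 1}"
  proof (rule inj_onI)
    fix i j assume "i \<in> {..<p - 1}" "j \<in> {..<p - 1}" "f i = f j"
    thus "i = j" using f(3)[of i] f(3)[of j] by (intro eqD) (auto intro: cong_trans cong_sym)
  qed
  hence "card S = p - 1" by (simp add: S_def card_image)
  moreover have "modular_sidon (p * (p - 1)) S"
    unfolding modular_sidon_def
  proof (intro conjI ballI impI)
    show "S \<subseteq> {..<p * (p - 1)}" using f(1) by (auto simp: S_def)
    fix a b c d assume "a \<in> S" "b \<in> S" "c \<in> S" "d \<in> S" and eq: "[a + b = c + d] (mod (p * (p - 1)))"
    then obtain i j k l where ijkl: "i < p - 1" "j < p - 1" "k < p - 1" "l < p - 1"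
      "a = f i" "b = f j" "c = f k" "d = f l" by (auto simp: S_def)
    have e1: "[f i + f j = f k + f l] (mod (p - 1))"
      using eq ijkl cong_modulus_mult_nat[of _ _ "p - 1" p] by (simp add: mult.commute)
    have e2: "[f i + f j = f k + f l] (mod p)"
      using eq ijkl cong_modulus_mult_nat[of _ _ p "p - 1"] by simp
    have s1: "[i + j = k + l] (mod (p - 1))"
      using e1 f(3) by (meson cong_add cong_sym cong_trans)
    have s2: "[g ^ i + g ^ j = g ^ k + g ^ l] (mod p)"
      using e2 f(2) by (meson cong_add cong_sym cong_trans)
    have s3: "[g ^ (i + j) = g ^ (k + l)] (mod p)"
      using s1 g' by (simp add: order_divides_expdiff)
    have "[int (g ^ i) = int (g ^ k)] (mod int p) \<or> [int (g ^ i) = int (g ^ l)] (mod int p)"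
    proof (rule cong_if_same_sum_and_product)
      show "prime (int p)" using assms by simp
      show "[int (g ^ i) + int (g ^ j) = int (g ^ k) + int (g ^ l)] (mod int p)"
        using s2 unfolding of_nat_add[symmetric] cong_int_iff .
      show "[int (g ^ i) * int (g ^ j) = int (g ^ k) * int (g ^ l)] (mod int p)"
        using s3 unfolding of_nat_mult[symmetric] cong_int_iff power_add .
    qed
    hence "[g ^ i = g ^ k] (mod p) \<or> [g ^ i = g ^ l] (mod p)" unfolding cong_int_iff .
    hence "[i = k] (mod (p - 1)) \<or> [i = l] (mod (p - 1))" using g' by (simp add: order_divides_expdiff)
    hence "i = k \<or> i = l" using eqD ijkl by blast
    thus "(a = c \<and> b = d) \<or> (a = d \<and> b = c)"
    proof
      assume "i = k"
      hence "[j = l] (mod (p - 1))" using s1 by (simp add: cong_add_lcancel_nat)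
      thus ?thesis using eqD ijkl \<open>i = k\<close> by blast
    next
      assume "i = l"
      hence "[j = k] (mod (p - 1))" using s1 by (simp add: cong_add_lcancel_nat add.commute[of k])
      thus ?thesis using eqD ijkl \<open>i = l\<close> by blast
    qed
  qed
  ultimately show ?thesis by blast
qed

text \<open>The number of ordered representations of \<open>k\<close> as a sum of two elements of \<open>A\<close>.\<close>

definition sum_reps :: "nat set \<Rightarrow> nat \<Rightarrow> nat" where
  "sum_reps A k = card {(a, b). a \<in> A \<and> b \<in> A \<and> a + b = k}"

lemma R_max_ge:
  assumes "T \<subseteq> {1..int n}" "\<And>k. self_conv T k \<le> g"
  shows "card T \<le> R_max g n"
proof -
  have fT: "finite T" using assms(1) finite_subset by blast
  have "self_conv_norm T \<le> g" unfolding self_conv_norm_def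
    using assms(2) finite_range_self_conv[OF fT] by (intro Max.boundedI) auto
  thus ?thesis unfolding R_max_def using assms(1) by (intro Max_ge R_max_set) auto
qed

text \<open>Interleaving translates of a modular Sidon set \<open>S\<close> by the multiples \<open>m * a\<close>, \<open>a \<in> A\<close>. If
\<open>(s\<^sub>1 + m * a\<^sub>1) + (s\<^sub>2 + m * a\<^sub>2)\<close> is prescribed, then so is \<open>s\<^sub>1 + s\<^sub>2\<close> modulo \<open>m\<close>, which leaves at most
two ordered pairs \<open>(s\<^sub>1, s\<^sub>2)\<close>; each of them prescribes \<open>a\<^sub>1 + a\<^sub>2\<close>, which leaves at most \<open>h\<close> pairs
\<open>(a\<^sub>1, a\<^sub>2)\<close>.\<close>

lemma interleave_bound:
  assumes S: "modular_sidon m S" and A: "A \<subseteq> {..<N}" "\<And>k. sum_reps A k \<le> h" and n: "m * N \<le> n"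
  shows "card S * card A \<le> R_max (2 * h) n"
proof -
  \<comment> \<open>The residues start at \<open>0\<close>, hence the shift by \<open>1\<close> into \<open>{1..n}\<close>; a sum of two
  shifted elements is \<open>2\<close> too large.\<close>
  define F where "F = (\<lambda>(s, a). int (s + m * a) + 1)"
  define T where "T = F ` (S \<times> A)"
  have Sm: "S \<subseteq> {..<m}" using S by (simp add: modular_sidon_def)
  have fin: "finite S" "finite A" using Sm A(1) finite_subset by blast+
  have inj: "inj_on F (S \<times> A)"
  proof (rule inj_onI, clarify)
    fix s a s' a' assume *: "s \<in> S" "a \<in> A" "s' \<in> S" "a' \<in> A" "F (s, a) = F (s', a')"
    hence lt: "s < m" "s' < m" and e: "s + m * a = s' + m * a'" 
      using Sm by (auto simp: F_def simp flip: of_nat_add of_nat_mult)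
    have "s = s'" using lt arg_cong[OF e, of "\<lambda>x. x mod m"] by simp
    moreover have "a = a'" using lt arg_cong[OF e, of "\<lambda>x. x div m"] by simp
    ultimately show "s = s' \<and> a = a'" by simp
  qed
  have "card T = card S * card A" unfolding T_def using inj by (simp add: card_image card_cartesian_product)
  moreover have "card T \<le> R_max (2 * h) n"
  proof (rule R_max_ge)
    show "T \<subseteq> {1..int n}"
    proof
      fix t assume "t \<in> T"
      then obtain s a where sa: "s \<in> S" "a \<in> A" "t = int (s + m * a) + 1" by (auto simp: T_def F_def)
      have "s < m" "a < N" using sa Sm A(1) by auto
      hence "s + m * a < m * (a + 1)" "m * (a + 1) \<le> m * N" by (simp, intro mult_left_mono) auto
      hence "s + m * a < n" using n by linarith
      hence "int (s + m * a) < int n" by (simp only: of_nat_less_iff)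
      thus "t \<in> {1..int n}" unfolding sa(3) by simp
    qed
    fix k
    \<comment> \<open>\<open>P\<close> collects the pairs of residues that occur, and \<open>B\<close> the pairs of blocks for each of them.\<close>
    define P where "P = {(s1, s2). s1 \<in> S \<and> s2 \<in> S \<and> (\<exists>a1 a2. int (s1 + s2 + m * (a1 + a2)) + 2 = k)}"
    define B where "B = (\<lambda>(s1, s2). {(a1, a2). a1 \<in> A \<and> a2 \<in> A \<and> int (s1 + s2 + m * (a1 + a2)) + 2 = k})"
    have fP: "finite P" by (rule finite_subset[of _ "S \<times> S"]) (auto simp: P_def fin)
    have fB: "finite (B x)" for x by (rule finite_subset[of _ "A \<times> A"]) (auto simp: B_def fin)
    have "{(t1, t2). t1 \<in> T \<and> t2 \<in> T \<and> t1 + t2 = k} \<subseteq>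
      (\<lambda>((s1, s2), (a1, a2)). (F (s1, a1), F (s2, a2))) ` Sigma P B"
    proof clarify
      fix t1 t2 assume t: "t1 \<in> T" "t2 \<in> T" "k = t1 + t2"
      obtain s1 a1 where 1: "s1 \<in> S" "a1 \<in> A" "t1 = F (s1, a1)" using t(1) by (auto simp: T_def)
      obtain s2 a2 where 2: "s2 \<in> S" "a2 \<in> A" "t2 = F (s2, a2)" using t(2) by (auto simp: T_def)
      have k: "int (s1 + s2 + m * (a1 + a2)) + 2 = k" using t 1 2 by (simp add: F_def algebra_simps)
      have "((s1, s2), (a1, a2)) \<in> Sigma P B" using 1 2 k by (auto simp: P_def B_def simp del: of_nat_add of_nat_mult)
      thus "(t1, t2) \<in> (\<lambda>((s1, s2), (a1, a2)). (F (s1, a1), F (s2, a2))) ` Sigma P B"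
        using 1 2 by force
    qed
    hence "self_conv T k \<le> card ((\<lambda>((s1, s2), (a1, a2)). (F (s1, a1), F (s2, a2))) ` Sigma P B)"
      unfolding self_conv_def using fP fB by (intro card_mono finite_imageI finite_SigmaI) auto
    also have "\<dots> \<le> card (Sigma P B)" using fP fB by (intro card_image_le finite_SigmaI) auto
    also have "\<dots> = (\<Sum>x\<in>P. card (B x))" using fP fB by (intro card_SigmaI) auto
    also have "\<dots> \<le> (\<Sum>x\<in>P. h)"
    proof (rule sum_mono)
      fix x assume "x \<in> P"
      then obtain s1 s2 b1 b2 where x: "x = (s1, s2)" "s1 \<in> S" "int (s1 + s2 + m * (b1 + b2)) + 2 = k"
        by (auto simp: P_def)
      have m: "m > 0" using x(2) Sm by auto
      have "B x \<subseteq> {(a, b). a \<in> A \<and> b \<in> A \<and> a + b = b1 + b2}"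
      proof
        fix y assume "y \<in> B x"
        then obtain a1 a2 where y: "y = (a1, a2)" "a1 \<in> A" "a2 \<in> A" "int (s1 + s2 + m * (a1 + a2)) + 2 = k"
          unfolding B_def x(1) by blast
        have "m * (a1 + a2) = m * (b1 + b2)" using x(3) y(4) by linarith
        hence "a1 + a2 = b1 + b2" using m by simp
        thus "y \<in> {(a, b). a \<in> A \<and> b \<in> A \<and> a + b = b1 + b2}" using y by simp
      qed
      hence "card (B x) \<le> sum_reps A (b1 + b2)" unfolding sum_reps_def
        by (intro card_mono finite_subset[of "{(a, b). a \<in> A \<and> b \<in> A \<and> a + b = b1 + b2}" "A \<times> A"]) (auto simp: fin)
      thus "card (B x) \<le> h" using A(2)[of "b1 + b2"] by linarith
    qed
    also have "\<dots> = card P * h" by simp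
    also have "card P \<le> 2"
    proof (cases "P = {}")
      case False
      then obtain u v a where uv: "u \<in> S" "v \<in> S" "int (u + v + m * a) + 2 = k"
        by (auto simp: P_def simp del: of_nat_add of_nat_mult)
      have "P \<subseteq> {(u, v), (v, u)}"
      proof
        fix x assume "x \<in> P"
        then obtain s1 s2 b where x: "x = (s1, s2)" "s1 \<in> S" "s2 \<in> S" "int (s1 + s2 + m * b) + 2 = k"
          by (auto simp: P_def simp del: of_nat_add of_nat_mult)
        have "s1 + s2 + m * b = u + v + m * a" using x(4) uv(3) by linarith
        from arg_cong[OF this, of "\<lambda>x. x mod m"] have "[s1 + s2 = u + v] (mod m)" by (simp add: cong_def)
        hence "(s1 = u \<and> s2 = v) \<or> (s1 = v \<and> s2 = u)"
          using S x uv unfolding modular_sidon_def by blast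
        thus "x \<in> {(u, v), (v, u)}" using x(1) by auto
      qed
      hence "card P \<le> card {(u, v), (v, u)}" by (intro card_mono) auto
      moreover have "card {(u, v), (v, u)} \<le> 2" using card_length[of "[(u, v), (v, u)]"] by simp
      ultimately show ?thesis by (rule order_trans)
    qed simp
    finally show "self_conv T k \<le> 2 * h" by simp
  qed
  ultimately show ?thesis by simp
qed

text \<open>An executable test that the list \<open>as\<close> enumerates, without repetition, a subset of
\<open>{0, ..., N - 1}\<close> in which every number has at most \<open>h\<close> representations. Only sums below \<open>2 * N\<close>
can occur.\<close>

definition reps_bounded :: "nat \<Rightarrow> nat \<Rightarrow> nat list \<Rightarrow> bool" where
  "reps_bounded h N as \<longleftrightarrow> distinct as \<and> list_all (\<lambda>a. a < N) as \<and>
     list_all (\<lambda>k. length (filter (\<lambda>a. a \<le> k \<and> k - a \<in> set as) as) \<le> h) [0..<2 * N]"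

lemma reps_boundedD:
  assumes "reps_bounded h N as"
  shows "set as \<subseteq> {..<N}" "card (set as) = length as" "sum_reps (set as) k \<le> h"
proof -
  have d: "distinct as" and N: "\<And>a. a \<in> set as \<Longrightarrow> a < N"
    and h: "\<And>k. k < 2 * N \<Longrightarrow> length (filter (\<lambda>a. a \<le> k \<and> k - a \<in> set as) as) \<le> h"
    using assms by (auto simp: reps_bounded_def list_all_iff)
  show "set as \<subseteq> {..<N}" "card (set as) = length as" using d N by (auto simp: distinct_card)
  have "{(a, b). a \<in> set as \<and> b \<in> set as \<and> a + b = k} = (\<lambda>a. (a, k - a)) ` {a \<in> set as. a \<le> k \<and> k - a \<in> set as}"
    by force
  hence "sum_reps (set as) k = card ((\<lambda>a. (a, k - a)) ` {a \<in> set as. a \<le> k \<and> k - a \<in> set as})"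
    by (simp add: sum_reps_def)
  also have "\<dots> = card {a \<in> set as. a \<le> k \<and> k - a \<in> set as}"
    by (intro card_image inj_onI) auto
  also have "\<dots> = length (filter (\<lambda>a. a \<le> k \<and> k - a \<in> set as) as)"
    using distinct_card[OF distinct_filter[OF d, of "\<lambda>a. a \<le> k \<and> k - a \<in> set as"]]
    unfolding set_filter .
  finally have eq: "sum_reps (set as) k = length (filter (\<lambda>a. a \<le> k \<and> k - a \<in> set as) as)" .
  show "sum_reps (set as) k \<le> h"
  proof (cases "k < 2 * N")
    case True
    thus ?thesis using eq h by simp
  next
    case False
    have "\<not> (a \<le> k \<and> k - a \<in> set as)" if "a \<in> set as" for a
      using N[of a] N[of "k - a"] that False by linarith
    hence "filter (\<lambda>a. a \<le> k \<and> k - a \<in> set as) as = []"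
      by (simp add: filter_empty_conv)
    thus ?thesis using eq by simp
  qed
qed

section \<open>Continuation of the zeta function\<close>

text \<open>The \<open>n\<close>-th term of a series for \<open>(s - 1) * \<zeta>(s)\<close>: the term \<open>(s - 1) * n powr (-s)\<close> minus
its approximation \<open>n powr (1 - s) - (n + 1) powr (1 - s)\<close>, which is the integral of
\<open>(s - 1) * x powr (-s)\<close> over the interval from \<open>n\<close> to \<open>n + 1\<close>. Since \<open>0 powr s = 0\<close>, the term
for \<open>n = 0\<close> is the constant \<open>1\<close>.\<close>

definition zeta_part :: "nat \<Rightarrow> complex \<Rightarrow> complex" where
  "zeta_part n s = (s - 1) * of_nat n powr (-s) - of_nat n powr (1 - s) + of_nat (Suc n) powr (1 - s)"

text \<open>The regularised zeta function \<open>(s - 1) * \<zeta>(s)\<close>, defined for \<open>Re s > 0\<close>.\<close>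

definition zeta_reg :: "complex \<Rightarrow> complex" where
  "zeta_reg s = (\<Sum>n. zeta_part n s)"

text \<open>The Dirichlet series of the zeta function, for \<open>Re s > 1\<close>. The index \<open>0\<close> contributes \<open>0\<close>.\<close>

definition zeta_ser :: "complex \<Rightarrow> complex" where
  "zeta_ser s = (\<Sum>n. of_nat n powr (-s))"

lemma norm_of_nat_powr: "norm (of_nat n powr (s::complex)) = real n powr Re s"
  by (cases "n = 0") (auto simp: norm_powr_real_powr)

text \<open>The term is the remainder of order two in the Taylor expansion of \<open>x powr (1 - s)\<close> at \<open>n\<close>,
evaluated at \<open>n + 1\<close>. This gains a factor \<open>1 / n\<close> and makes the series converge for \<open>Re s > 0\<close>.\<close>

lemma norm_zeta_part_le:
  assumes "n \<ge> 1" "Re s > 0"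
  shows "norm (zeta_part n s) \<le> norm (s - 1) * norm s * real n powr (- Re s - 1)"
proof -
  define S where "S = closed_segment (of_nat n :: complex) (of_nat (Suc n))"
  define f :: "nat \<Rightarrow> complex \<Rightarrow> complex" where
    "f i x = (if i = 0 then x powr (1 - s) else if i = 1 then (1 - s) * x powr (- s)
              else (1 - s) * (- s) * x powr (- s - 1))" for i x
  have S: "x \<in> \<real> \<and> Re x \<ge> real n \<and> x \<noteq> 0 \<and> x \<notin> \<real>\<^sub>\<le>\<^sub>0" if xS: "x \<in> S" for x
  proof -
    obtain u where u: "x = (1 - u) *\<^sub>R of_nat n + u *\<^sub>R of_nat (Suc n)" "0 \<le> u" "u \<le> 1"
      using xS by (auto simp: S_def closed_segment_def)
    hence "x = of_real (real n + u)" by (simp add: scaleR_conv_of_real algebra_simps)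
    moreover from this have "x \<in> \<real>" by simp
    ultimately show ?thesis using u(2) assms 
      by (auto simp: complex_nonpos_Reals_iff complex_eq_iff)
  qed
  have "norm (f 0 (of_nat (Suc n)) - (\<Sum>i\<le>1. f i (of_nat n) * (of_nat (Suc n) - of_nat n) ^ i / fact i))
      \<le> (norm (s - 1) * norm s * real n powr (- Re s - 1)) * norm (of_nat (Suc n) - of_nat n :: complex) ^ Suc 1 / fact 1"
  proof (rule complex_Taylor[where S = S])
    show "convex S" unfolding S_def by auto
    show "(f i has_field_derivative f (Suc i) x) (at x within S)" if "x \<in> S" "i \<le> 1" for i x
    proof -
      have x: "x \<notin> \<real>\<^sub>\<le>\<^sub>0" using S that by auto
      have d0: "((\<lambda>x. x powr (1 - s)) has_field_derivative (1 - s) * x powr (- s)) (at x within S)"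
        using has_field_derivative_powr[OF x, of "1 - s"] by (auto intro: has_field_derivative_at_within)
      have "((\<lambda>x. (1 - s) * x powr (- s)) has_field_derivative (1 - s) * ((- s) * x powr (- s - 1))) (at x)"
        by (rule DERIV_cmult[OF has_field_derivative_powr[OF x]])
      hence d1: "((\<lambda>x. (1 - s) * x powr (- s)) has_field_derivative (1 - s) * (- s) * x powr (- s - 1)) (at x within S)"
        by (simp add: mult.assoc has_field_derivative_at_within)
      from that consider "i = 0" | "i = 1" by linarith
      thus ?thesis
        using d0 d1 by cases (simp_all add: f_def[abs_def])
    qed
    show "norm (f (Suc 1) x) \<le> norm (s - 1) * norm s * real n powr (- Re s - 1)" if "x \<in> S" for x
    proof -
      have "norm (x powr (- s - 1)) = Re x powr (- Re s - 1)"
        using S[OF that] by (subst norm_powr_real_powr) auto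
      also have "\<dots> \<le> real n powr (- Re s - 1)"
        using S[OF that] assms by (intro powr_mono2') auto
      finally show ?thesis
        by (auto simp: f_def norm_mult norm_minus_commute intro!: mult_left_mono)
    qed
  qed (auto simp: S_def)
  also have "f 0 (of_nat (Suc n)) - (\<Sum>i\<le>1. f i (of_nat n) * (of_nat (Suc n) - of_nat n) ^ i / fact i) = zeta_part n s"
    by (simp add: f_def zeta_part_def algebra_simps)
  finally show ?thesis by simp
qed

lemma zeta_part_holomorphic: "zeta_part n holomorphic_on S"
proof (cases "n = 0")
  case True
  thus ?thesis by (simp add: zeta_part_def[abs_def])
next
  case False
  thus ?thesis unfolding zeta_part_def[abs_def]
    by (intro holomorphic_intros) auto
qed

lemma summable_real_powr: "a < -1 \<Longrightarrow> summable (\<lambda>n. real n powr a)"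
  by (simp add: summable_real_powr_iff)

lemma zeta_part_termwise_derivative:
  "\<exists>g g'. \<forall>s\<in>{s. Re s > 0}. (\<lambda>n. zeta_part n s) sums g s \<and>
      (\<lambda>n. deriv (zeta_part n) s) sums g' s \<and> (g has_field_derivative g' s) (at s)"
proof (rule series_and_derivative_comparison_complex)
  show op: "open {s. Re s > 0}" by (rule open_halfspace_Re_gt)
  show "(zeta_part n has_field_derivative deriv (zeta_part n) x) (at x)" for n x
    by (rule holomorphic_derivI[OF zeta_part_holomorphic open_UNIV]) auto
  fix x :: complex assume "x \<in> {s. Re s > 0}"
  hence x: "Re x > 0" by auto
  define d where "d = Re x / 2"
  define h :: "nat \<Rightarrow> complex" where
    "h n = of_real ((norm x + d + 1) * (norm x + d) * real n powr (- d - 1))" for n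
  have d: "d > 0" using x by (auto simp: d_def)
  have "summable h" unfolding h_def using d
    by (intro summable_of_real summable_mult summable_real_powr) auto
  moreover have "range h \<subseteq> \<real>\<^sub>\<ge>\<^sub>0" using d by (auto simp: h_def)
  moreover have "\<forall>\<^sub>F n in sequentially. \<forall>y\<in>ball x d \<inter> {s. Re s > 0}. norm (zeta_part n y) \<le> norm (h n)"
    using eventually_ge_at_top[of 1]
  proof eventually_elim
    case (elim n)
    show ?case
    proof
      fix y assume y: "y \<in> ball x d \<inter> {s. Re s > 0}"
      have nxy: "norm (x - y) < d" using y by (auto simp: dist_norm)
      have "Re x - Re y \<le> norm (x - y)" using complex_Re_le_cmod[of "x - y"] by simp
      hence Rey: "Re y \<ge> d" using nxy by (simp add: d_def)
      have ny: "norm y \<le> norm x + d" using nxy norm_triangle_ineq3[of x y] by linarith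
      have "norm (y - 1) \<le> norm y + 1" using norm_triangle_ineq4[of y 1] by simp
      hence ny1: "norm (y - 1) \<le> norm x + d + 1" using ny by simp
      have "norm (zeta_part n y) \<le> norm (y - 1) * norm y * real n powr (- Re y - 1)"
        using elim y by (intro norm_zeta_part_le) auto
      also have "\<dots> \<le> (norm x + d + 1) * (norm x + d) * real n powr (- d - 1)"
        using ny ny1 d elim Rey by (intro mult_mono powr_mono) auto
      also have "\<dots> = norm (h n)" unfolding h_def norm_of_real using d by (subst abs_of_nonneg) auto
      finally show "norm (zeta_part n y) \<le> norm (h n)" .
    qed
  qed
  ultimately show "\<exists>d h. 0 < d \<and> summable (h :: nat \<Rightarrow> complex) \<and> range h \<subseteq> \<real>\<^sub>\<ge>\<^sub>0 \<and>
      (\<forall>\<^sub>F n in sequentially. \<forall>y\<in>ball x d \<inter> {s. Re s > 0}. norm (zeta_part n y) \<le> norm (h n))"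
    by (intro exI[of _ d] exI[of _ h] conjI d)
qed

lemma zeta_reg_sums: "Re s > 0 \<Longrightarrow> (\<lambda>n. zeta_part n s) sums zeta_reg s"
  using zeta_part_termwise_derivative unfolding zeta_reg_def by (auto simp: sums_iff)

lemma zeta_reg_holomorphic: "zeta_reg holomorphic_on {s. Re s > 0}"
proof -
  obtain g g' where g: "\<And>s. Re s > 0 \<Longrightarrow> (\<lambda>n. zeta_part n s) sums g s"
     "\<And>s. Re s > 0 \<Longrightarrow> (g has_field_derivative g' s) (at s)"
    using zeta_part_termwise_derivative by auto
  have "g holomorphic_on {s. Re s > 0}"
    using g(2) by (auto simp: holomorphic_on_open open_halfspace_Re_gt)
  moreover have "g s = zeta_reg s" if "Re s > 0" for s
    using g(1)[OF that] zeta_reg_sums[OF that] sums_unique2 by blast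
  ultimately show ?thesis using holomorphic_transform[of g _ zeta_reg] by auto
qed

lemma zeta_reg_1: "zeta_reg 1 = 1"
proof -
  have "(\<lambda>n. zeta_part n 1) = (\<lambda>n. if n = 0 then 1 else 0)"
    by (auto simp: zeta_part_def fun_eq_iff simp del: of_nat_Suc)
  moreover have "(\<lambda>n. if n = 0 then 1 else 0) sums (1::complex)"
    using sums_single[of 0 "\<lambda>_. 1::complex"] by simp
  ultimately show ?thesis unfolding zeta_reg_def by (simp add: sums_iff)
qed

lemma summable_zeta_ser: "Re s > 1 \<Longrightarrow> summable (\<lambda>n. norm (of_nat n powr (-s) :: complex))"
  unfolding norm_of_nat_powr by (intro summable_real_powr) auto

text \<open>For \<open>Re s > 1\<close> the correction terms of the series telescope to \<open>0\<close>.\<close>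

lemma zeta_reg_eq:
  assumes "Re s > 1"
  shows "zeta_reg s = (s - 1) * zeta_ser s"
proof -
  have 1: "(\<lambda>n. of_nat n powr (-s)) sums zeta_ser s"
    using summable_zeta_ser[OF assms] unfolding zeta_ser_def
    by (intro summable_sums summable_norm_cancel[of "\<lambda>n. of_nat n powr (-s)"]) 
  have "(\<lambda>n. of_nat (Suc n) powr (1 - s) - of_nat n powr (1 - s)) sums (0 - of_nat 0 powr (1 - s))"
  proof (rule telescope_sums)
    have "(\<lambda>n. real n powr (1 - Re s)) \<longlonglongrightarrow> 0"
      using assms by (intro tendsto_neg_powr) (auto simp: filterlim_real_sequentially)
    thus "(\<lambda>n. of_nat n powr (1 - s)) \<longlonglongrightarrow> 0"
      by (intro tendsto_norm_zero_cancel[of "\<lambda>n. of_nat n powr (1 - s)"]) (simp add: norm_of_nat_powr)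
  qed
  from sums_add[OF sums_mult[OF 1, of "s - 1"] this]
  have "(\<lambda>n. zeta_part n s) sums ((s - 1) * zeta_ser s)"
    by (simp add: zeta_part_def algebra_simps)
  thus ?thesis unfolding zeta_reg_def by (simp add: sums_iff)
qed

lemma zeta_ser_termwise_derivative:
  "\<exists>g g'. \<forall>s\<in>{s. Re s > 1}. (\<lambda>n. of_nat n powr (-s)) sums g s \<and>
      (\<lambda>n. - (of_real (ln (real n)) * of_nat n powr (-s))) sums g' s \<and> (g has_field_derivative g' s) (at s)"
proof (rule series_and_derivative_comparison_complex)
  show op: "open {s. Re s > 1}" by (rule open_halfspace_Re_gt)
  show "((\<lambda>s. of_nat n powr (-s)) has_field_derivative - (of_real (ln (real n)) * of_nat n powr (-x))) (at x)" for n and x :: complex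
  proof (cases "n = 0")
    case False
    have "((\<lambda>s. of_nat n powr (-s)) has_field_derivative of_nat n powr (-x) * Ln (of_nat n) * (-1)) (at x)"
      using False unfolding powr_def by (auto intro!: derivative_eq_intros simp del: Ln_of_nat)
    thus ?thesis using False by (simp add: Ln_of_nat mult_ac)
  qed auto
  fix x :: complex assume "x \<in> {s. Re s > 1}"
  hence x: "Re x > 1" by auto
  define d where "d = (Re x - 1) / 2"
  define h :: "nat \<Rightarrow> complex" where "h n = of_real (real n powr (- d - 1))" for n
  have d: "d > 0" using x by (auto simp: d_def)
  have "summable h" unfolding h_def using d
    by (intro summable_of_real summable_real_powr) auto
  moreover have "range h \<subseteq> \<real>\<^sub>\<ge>\<^sub>0" using d by (auto simp: h_def)
  moreover have "\<forall>\<^sub>F n in sequentially. \<forall>y\<in>ball x d \<inter> {s. Re s > 1}. norm (of_nat n powr (-y) :: complex) \<le> norm (h n)"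
    using eventually_ge_at_top[of 1]
  proof eventually_elim
    case (elim n)
    show ?case
    proof
      fix y assume y: "y \<in> ball x d \<inter> {s. Re s > 1}"
      have nxy: "norm (x - y) < d" using y by (auto simp: dist_norm)
      have "Re x - Re y \<le> norm (x - y)" using complex_Re_le_cmod[of "x - y"] by simp
      hence Rey: "Re y \<ge> d + 1" using nxy by (simp add: d_def field_simps)
      have "real n powr (- Re y) \<le> real n powr (- d - 1)"
        using elim Rey by (intro powr_mono) auto
      thus "norm (of_nat n powr (-y) :: complex) \<le> norm (h n)"
        by (simp add: norm_of_nat_powr h_def)
    qed
  qed
  ultimately show "\<exists>d h. 0 < d \<and> summable (h :: nat \<Rightarrow> complex) \<and> range h \<subseteq> \<real>\<^sub>\<ge>\<^sub>0 \<and>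
      (\<forall>\<^sub>F n in sequentially. \<forall>y\<in>ball x d \<inter> {s. Re s > 1}. norm (of_nat n powr (-y) :: complex) \<le> norm (h n))"
    by (intro exI[of _ d] exI[of _ h] conjI d)
qed

lemma zeta_ser_deriv:
  assumes "Re s > 1"
  shows "(zeta_ser has_field_derivative deriv zeta_ser s) (at s)"
    and "(\<lambda>n. of_real (ln (real n)) * of_nat n powr (-s)) sums (- deriv zeta_ser s)"
proof -
  obtain g g' where g: "\<And>s. Re s > 1 \<Longrightarrow> (\<lambda>n. of_nat n powr (-s)) sums g s"
     "\<And>s. Re s > 1 \<Longrightarrow> (\<lambda>n. - (of_real (ln (real n)) * of_nat n powr (-s))) sums g' s"
     "\<And>s. Re s > 1 \<Longrightarrow> (g has_field_derivative g' s) (at s)"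
    using zeta_ser_termwise_derivative by auto
  have eq: "g s = zeta_ser s" if "Re s > 1" for s
    using g(1)[OF that] unfolding zeta_ser_def by (simp add: sums_iff)
  have "(zeta_ser has_field_derivative g' s) (at s)"
    by (rule has_field_derivative_transform_within_open[OF g(3)[OF assms] open_halfspace_Re_gt[of 1]])
       (use eq assms in auto)
  moreover from this have "deriv zeta_ser s = g' s" by (rule DERIV_imp_deriv)
  ultimately show "(zeta_ser has_field_derivative deriv zeta_ser s) (at s)" 
    "(\<lambda>n. of_real (ln (real n)) * of_nat n powr (-s)) sums (- deriv zeta_ser s)"
    using sums_minus[OF g(2)[OF assms]] by simp_all
qed

section \<open>Zeros of the zeta function\<close>

text \<open>The Dirichlet series of the von Mangoldt function, for \<open>Re s > 1\<close>.\<close>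

definition mangoldt_ser :: "complex \<Rightarrow> complex" where
  "mangoldt_ser s = (\<Sum>n. mangoldt n * of_nat n powr (-s))"

lemma summable_mangoldt:
  assumes "a > 1"
  shows "summable (\<lambda>n. mangoldt n * real n powr (-a))"
proof -
  have "(\<lambda>n. of_real (ln (real n)) * of_nat n powr (- of_real a) :: complex) sums (- deriv zeta_ser (of_real a))"
    using assms by (intro zeta_ser_deriv) auto
  hence "summable (\<lambda>n. Re (of_real (ln (real n)) * of_nat n powr (- of_real a)))"
    by (intro summable_Re) (auto simp: sums_iff)
  also have "(\<lambda>n. Re (of_real (ln (real n)) * of_nat n powr (- of_real a))) = (\<lambda>n. ln (real n) * real n powr (-a))"
  proof
    fix n :: nat
    have "of_nat n powr (- of_real a) = (of_real (real n powr (-a)) :: complex)"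
      using powr_of_real[of "real n" "-a"] by simp
    thus "Re (of_real (ln (real n)) * of_nat n powr (- of_real a)) = ln (real n) * real n powr (-a)"
      by (simp only: of_real_mult[symmetric] Re_complex_of_real)
  qed
  finally have s: "summable (\<lambda>n. ln (real n) * real n powr (-a))" .
  show ?thesis
  proof (rule summable_comparison_test[OF _ s], intro exI[of _ 1] allI impI)
    fix n :: nat assume "n \<ge> 1"
    thus "norm (mangoldt n * real n powr (-a)) \<le> ln (real n) * real n powr (-a)"
      using mangoldt_le[of n] by (auto simp: abs_mult intro!: mult_right_mono)
  qed
qed

lemma summable_norm_mangoldt:
  assumes "Re s > 1"
  shows "summable (\<lambda>n. norm (mangoldt n * of_nat n powr (-s) :: complex))"
  using summable_mangoldt[OF assms] by (simp add: norm_mult norm_of_nat_powr)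

lemma mangoldt_ser_sums:
  assumes "Re s > 1"
  shows "(\<lambda>n. mangoldt n * of_nat n powr (-s)) sums mangoldt_ser s"
  unfolding mangoldt_ser_def
  by (intro summable_sums summable_norm_cancel[OF summable_norm_mangoldt[OF assms]])

lemma has_sum_pos_nat:
  fixes f :: "nat \<Rightarrow> 'a :: banach"
  assumes "summable (\<lambda>n. norm (f n))" "f sums S" "f 0 = 0"
  shows "(f has_sum S) {1..}" "(\<lambda>n. norm (f n)) summable_on {1..}"
proof -
  have "(f has_sum S) UNIV" by (rule norm_summable_imp_has_sum[OF assms(1,2)])
  also have "?this \<longleftrightarrow> (f has_sum S) {1..}"
    using assms(3) by (intro has_sum_cong_neutral) (auto simp: Suc_le_eq)
  finally show "(f has_sum S) {1..}" .
  have "(\<lambda>n. norm (f n)) summable_on UNIV"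
    using assms(1) by (intro norm_summable_imp_summable_on) auto
  thus "(\<lambda>n. norm (f n)) summable_on {1..}"
    by (rule summable_on_subset_banach) auto
qed

text \<open>The identity \<open>\<Lambda> * 1 = ln\<close> of Dirichlet convolutions, as an identity of Dirichlet series.\<close>

lemma mangoldt_ser_times_zeta_ser:
  assumes s: "Re s > 1"
  shows "mangoldt_ser s * zeta_ser s = - deriv zeta_ser s"
proof -
  define f g :: "nat \<Rightarrow> complex" where "f n = mangoldt n * of_nat n powr (-s)" and "g n = of_nat n powr (-s)" for n
  note f = has_sum_pos_nat[OF summable_norm_mangoldt[OF s] mangoldt_ser_sums[OF s], folded f_def, simplified]
  have gs: "g sums zeta_ser s" using summable_zeta_ser[OF s] unfolding zeta_ser_def g_def
    by (intro summable_sums summable_norm_cancel[of "\<lambda>n. of_nat n powr (-s)"])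
  note g = has_sum_pos_nat[of g, OF summable_zeta_ser[OF s, folded g_def] gs]
  have g0: "g 0 = 0" "f 0 = 0" by (auto simp: g_def f_def)
  define A :: "nat set" where "A = {1..}"
  have f1: "(f has_sum mangoldt_ser s) A" "(\<lambda>n. norm (f n)) summable_on A"
    and g1: "(g has_sum zeta_ser s) A" "(\<lambda>n. norm (g n)) summable_on A"
    using f g g0 by (auto simp: A_def)
  have sm: "(\<lambda>(a,b). f a * g b) summable_on A \<times> A"
  proof (rule abs_summable_summable)
    have "(\<lambda>(a,b). norm (f a) * norm (g b)) summable_on (A \<times> A)"
    proof (rule summable_on_SigmaI)
      fix x assume "x \<in> A"
      show "((\<lambda>y. case (x, y) of (a, b) \<Rightarrow> norm (f a) * norm (g b)) has_sum 
              norm (f x) * infsum (\<lambda>n. norm (g n)) A) A"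
        using g1(2) by (auto intro!: has_sum_cmult_right has_sum_infsum)
    next
      show "(\<lambda>x. norm (f x) * (\<Sum>\<^sub>\<infinity>n\<in>A. norm (g n))) summable_on A"
        by (intro summable_on_cmult_left f1)
    qed auto
    thus "(\<lambda>x. norm (case x of (a, b) \<Rightarrow> f a * g b)) summable_on A \<times> A"
      by (simp add: case_prod_unfold norm_mult)
  qed
  have "((\<lambda>(a,b). f a * g b) has_sum (mangoldt_ser s * zeta_ser s)) (A \<times> A)"
    by (rule has_sum_SigmaI[OF _ _ sm, where g = "\<lambda>a. f a * zeta_ser s"])
       (auto intro!: has_sum_cmult_right has_sum_cmult_left f1 g1)
  \<comment> \<open>Regroup the pairs \<open>(a, b)\<close> by their product \<open>n = a * b\<close>.\<close>
  also have "?this \<longleftrightarrow> ((\<lambda>(n,d). f d * g (n div d)) has_sum (mangoldt_ser s * zeta_ser s)) (SIGMA n:A. {d. d dvd n})"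
  proof (rule has_sum_reindex_bij_witness[of _ "\<lambda>(n,d). (d, n div d)" "\<lambda>(a,b). (a * b, a)"])
    fix b assume "b \<in> (SIGMA n:A. {d. d dvd n})"
    then obtain n d where b: "b = (n, d)" "n > 0" "d dvd n" by (auto simp: A_def)
    from b(3) obtain k where k: "n = d * k" by blast
    show "(case case b of (n, d) \<Rightarrow> (d, n div d) of (a, b) \<Rightarrow> (a * b, a)) = b"
         "(case b of (n, d) \<Rightarrow> (d, n div d)) \<in> A \<times> A"
      using b(2) unfolding b(1) k by (auto simp: A_def)
  qed (auto simp: A_def)
  finally have "((\<lambda>(n,d). f d * g (n div d)) has_sum (mangoldt_ser s * zeta_ser s)) (SIGMA n:A. {d. d dvd n})" .
  hence "((\<lambda>n. \<Sum>d | d dvd n. f d * g (n div d)) has_sum (mangoldt_ser s * zeta_ser s)) A"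
  proof (rule has_sum_SigmaD)
    fix n assume "n \<in> A"
    hence "finite {d. d dvd n}" by (auto simp: A_def)
    from has_sum_finite[OF this, of "\<lambda>d. f d * g (n div d)"]
    show "((\<lambda>y. case (n, y) of (n, d) \<Rightarrow> f d * g (n div d)) has_sum (\<Sum>d | d dvd n. f d * g (n div d))) {d. d dvd n}"
      by simp
  qed
  also have "?this \<longleftrightarrow> ((\<lambda>n. of_real (ln (real n)) * of_nat n powr (-s)) has_sum (mangoldt_ser s * zeta_ser s)) A"
  proof (rule has_sum_cong)
    fix n assume "n \<in> A"
    hence n: "n > 0" by (auto simp: A_def)
    have "(\<Sum>d | d dvd n. f d * g (n div d)) = (\<Sum>d | d dvd n. mangoldt d * of_nat n powr (-s))"
    proof (rule sum.cong)
      fix d assume "d \<in> {d. d dvd n}"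
      then obtain k where k: "n = d * k" by auto
      have "(of_nat n :: complex) powr (-s) = of_nat d powr (-s) * of_nat k powr (-s)"
        unfolding k of_nat_mult by (intro powr_times_real) auto
      thus "f d * g (n div d) = mangoldt d * of_nat n powr (-s)"
        using k n by (simp add: f_def g_def)
    qed auto
    also have "\<dots> = of_real (ln (real n)) * of_nat n powr (-s)"
      using mangoldt_sum[of n, where 'a = complex] n by (simp flip: sum_distrib_right)
    finally show "(\<Sum>d | d dvd n. f d * g (n div d)) = of_real (ln (real n)) * of_nat n powr (-s)" .
  qed
  finally have "((\<lambda>n. of_real (ln (real n)) * of_nat n powr (-s)) has_sum (mangoldt_ser s * zeta_ser s)) A" .
  also have "?this \<longleftrightarrow> ((\<lambda>n. of_real (ln (real n)) * of_nat n powr (-s)) has_sum (mangoldt_ser s * zeta_ser s)) UNIV"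
    by (rule has_sum_cong_neutral) (auto simp: A_def Suc_le_eq)
  finally have "(\<lambda>n. of_real (ln (real n)) * of_nat n powr (-s)) sums (mangoldt_ser s * zeta_ser s)"
    by (rule has_sum_imp_sums)
  with zeta_ser_deriv(2)[OF s] show ?thesis using sums_unique2 by blast
qed

lemma mangoldt_ser_eq:
  assumes "Re s > 1" "zeta_reg s \<noteq> 0"
  shows "mangoldt_ser s = 1 / (s - 1) - deriv zeta_reg s / zeta_reg s"
proof -
  have "((\<lambda>s. (s - 1) * zeta_ser s) has_field_derivative (zeta_ser s + deriv zeta_ser s * (s - 1))) (at s)"
    using zeta_ser_deriv(1)[OF assms(1)] by (auto intro!: derivative_eq_intros)
  hence "(zeta_reg has_field_derivative (zeta_ser s + deriv zeta_ser s * (s - 1))) (at s)"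
    by (rule has_field_derivative_transform_within_open[OF _ open_halfspace_Re_gt[of 1]])
       (use assms zeta_reg_eq in auto)
  hence 1: "deriv zeta_reg s = zeta_ser s + deriv zeta_ser s * (s - 1)"
    by (rule DERIV_imp_deriv)
  have 2: "zeta_reg s = (s - 1) * zeta_ser s" by (rule zeta_reg_eq[OF assms(1)])
  have 3: "deriv zeta_ser s = - (mangoldt_ser s * zeta_ser s)"
    using mangoldt_ser_times_zeta_ser[OF assms(1)] by simp
  have "s \<noteq> 1" "zeta_ser s \<noteq> 0" using assms 2 by auto
  thus ?thesis unfolding 1 2 3 by (simp add: divide_simps)
qed

text \<open>The order \<open>k\<close> of vanishing of \<open>f\<close> at \<open>s0\<close> is read off from the logarithmic derivative along the
horizontal ray to the right of \<open>s0\<close>. Here \<open>k = 0\<close> if \<open>f s0 \<noteq> 0\<close>.\<close>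

lemma log_deriv_order:
  assumes "f holomorphic_on S" "open S" "connected S" "s0 \<in> S" "s1 \<in> S" "f s1 \<noteq> 0"
  obtains k :: nat where 
    "((\<lambda>x::real. of_real x * (deriv f (s0 + of_real x) / f (s0 + of_real x))) \<longlongrightarrow> of_nat k) (at_right 0)"
    "eventually (\<lambda>x::real. f (s0 + of_real x) \<noteq> 0) (at_right 0)" "f s0 = 0 \<Longrightarrow> k > 0"
proof -
  obtain g r k where g: "r > 0" "ball s0 r \<subseteq> S" "g holomorphic_on ball s0 r"
     "\<And>w. w \<in> ball s0 r \<Longrightarrow> f w = (w - s0) ^ k * g w" "\<And>w. w \<in> ball s0 r \<Longrightarrow> g w \<noteq> 0"
     "f s0 = 0 \<Longrightarrow> k > 0"
  proof (cases "f s0 = 0")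
    case True
    have "\<not> f constant_on S"
      using assms True unfolding constant_on_def by metis
    from holomorphic_factor_zero_nonconstant[OF assms(1,2,3,4) True this]
    show ?thesis using that by metis
  next
    case False
    have "continuous_on S f" using assms(1) by (rule holomorphic_on_imp_continuous_on)
    hence "open (S \<inter> f -` (-{0}))"
      using assms(2) by (intro continuous_open_preimage) auto
    moreover have "s0 \<in> S \<inter> f -` (-{0})" using assms False by auto
    ultimately obtain r where r: "r > 0" "ball s0 r \<subseteq> S \<inter> f -` (-{0})"
      unfolding open_contains_ball by blast
    show ?thesis
      by (rule that[of r f 0]) (use r False assms(1) in \<open>auto intro: holomorphic_on_subset\<close>)
  qed
  have ev: "eventually (\<lambda>x::real. x > 0 \<and> s0 + of_real x \<in> ball s0 r) (at_right 0)"
    using eventually_at_right_real[OF g(1)] by eventually_elim (auto simp: dist_norm)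
  have lim0: "((\<lambda>x::real. s0 + of_real x) \<longlongrightarrow> s0) (at_right 0)"
    by (auto intro!: tendsto_eq_intros)
  have "isCont g s0" "isCont (deriv g) s0"
    using g(1,3) by (auto intro!: holomorphic_on_imp_continuous_on continuous_on_interior[of "ball s0 r"]
        holomorphic_deriv simp: interior_open)
  hence "((\<lambda>x::real. of_nat k + of_real x * (deriv g (s0 + of_real x) / g (s0 + of_real x))) \<longlongrightarrow> 
           of_nat k + of_real 0 * (deriv g s0 / g s0)) (at_right 0)"
    using g(1,5) by (intro tendsto_intros isCont_tendsto_compose[OF _ lim0]) auto
  moreover have "\<forall>\<^sub>F x in at_right (0::real). of_nat k + of_real x * (deriv g (s0 + of_real x) / g (s0 + of_real x)) =
       of_real x * (deriv f (s0 + of_real x) / f (s0 + of_real x))"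
    using ev
  proof eventually_elim
    case (elim x)
    define w where "w = s0 + of_real x"
    have w: "w \<in> ball s0 r" "w - s0 = of_real x" and x: "x > 0" using elim by (auto simp: w_def)
    have "(g has_field_derivative deriv g w) (at w)"
      by (rule holomorphic_derivI[OF g(3) open_ball w(1)])
    hence "((\<lambda>w. (w - s0) ^ k * g w) has_field_derivative 
        (w - s0) ^ k * deriv g w + of_nat k * (w - s0) ^ (k - 1) * g w) (at w)"
      by (auto intro!: derivative_eq_intros)
    hence "(f has_field_derivative (w - s0) ^ k * deriv g w + of_nat k * (w - s0) ^ (k - 1) * g w) (at w)"
      by (rule has_field_derivative_transform_within_open[OF _ open_ball w(1)]) (use g(4) in auto)
    hence d: "deriv f w = (w - s0) ^ k * deriv g w + of_nat k * (w - s0) ^ (k - 1) * g w"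
      by (rule DERIV_imp_deriv)
    have "of_nat k * (of_real x * of_real x ^ (k - 1)) = of_nat k * (of_real x ^ k :: complex)"
      by (cases k) auto
    thus ?case
      unfolding w_def[symmetric] d g(4)[OF w(1)] w(2) using x g(5)[OF w(1)]
      by (auto simp: divide_simps algebra_simps)
  qed
  ultimately have "((\<lambda>x::real. of_real x * (deriv f (s0 + of_real x) / f (s0 + of_real x))) \<longlongrightarrow> of_nat k) (at_right 0)"
    by (auto intro: Lim_transform_eventually)
  moreover have "eventually (\<lambda>x::real. f (s0 + of_real x) \<noteq> 0) (at_right 0)"
    using ev by eventually_elim (use g(4,5) in auto)
  ultimately show ?thesis using that g(6) by blast
qed

text \<open>A zero of \<open>zeta_reg\<close> of order \<open>k\<close> at \<open>s0\<close> makes the von Mangoldt series behave like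
\<open>- k / (s - s0)\<close>; the pole of \<open>\<zeta>\<close> at \<open>1\<close> contributes \<open>1 / (s - 1)\<close>.\<close>

lemma mangoldt_ser_order:
  assumes "Re s0 \<ge> 1"
  obtains k :: nat where 
    "((\<lambda>x::real. of_real x * mangoldt_ser (s0 + of_real x)) \<longlongrightarrow> (if s0 = 1 then 1 else 0) - of_nat k) (at_right 0)"
    "zeta_reg s0 = 0 \<Longrightarrow> k > 0"
proof -
  have "connected {s. Re s > 0}" by (intro convex_connected convex_halfspace_Re_gt)
  then obtain k :: nat where 
    k: "((\<lambda>x::real. of_real x * (deriv zeta_reg (s0 + of_real x) / zeta_reg (s0 + of_real x))) \<longlongrightarrow> of_nat k) (at_right 0)"
    "eventually (\<lambda>x::real. zeta_reg (s0 + of_real x) \<noteq> 0) (at_right 0)" "zeta_reg s0 = 0 \<Longrightarrow> k > 0"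
    by (rule log_deriv_order[OF zeta_reg_holomorphic open_halfspace_Re_gt, of s0 1])
       (use assms zeta_reg_1 in auto)
  have "((\<lambda>x::real. of_real x * (1 / (s0 + of_real x - 1))) \<longlongrightarrow> (if s0 = 1 then 1 else 0)) (at_right 0)"
  proof (cases "s0 = 1")
    case True
    have "\<forall>\<^sub>F x in at_right (0::real). 1 = (of_real x * (1 / (s0 + of_real x - 1)) :: complex)"
      using eventually_at_right_less[of 0] by eventually_elim (auto simp: True)
    thus ?thesis using True by (auto intro: Lim_transform_eventually[OF tendsto_const])
  next
    case False
    thus ?thesis by (auto intro!: tendsto_eq_intros)
  qed
  from tendsto_diff[OF this k(1)]
  have "((\<lambda>x::real. of_real x * mangoldt_ser (s0 + of_real x)) \<longlongrightarrow> (if s0 = 1 then 1 else 0) - of_nat k) (at_right 0)"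
  proof (rule Lim_transform_eventually)
    show "\<forall>\<^sub>F x in at_right 0. of_real x * (1 / (s0 + of_real x - 1)) -
          of_real x * (deriv zeta_reg (s0 + of_real x) / zeta_reg (s0 + of_real x))
        = of_real x * mangoldt_ser (s0 + of_real x)"
      using k(2) eventually_at_right_less[of 0]
      by eventually_elim (use assms in \<open>auto simp: mangoldt_ser_eq algebra_simps\<close>)
  qed
  thus ?thesis using that k(3) by blast
qed

lemma of_nat_powr_polar:
  assumes "n > 0"
  shows "of_nat n powr (- Complex a t) = of_real (real n powr (-a)) * cis (- (t * ln (real n)))"
  using assms by (simp add: powr_def complex_eq_iff exp_eq_polar Re_exp Im_exp algebra_simps)

lemma Re_mangoldt_ser_sums:
  assumes "a > 1"
  shows "(\<lambda>n. mangoldt n * real n powr (-a) * cos (t * ln (real n))) sums Re (mangoldt_ser (Complex a t))"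
proof -
  have "(\<lambda>n. Re (mangoldt n * of_nat n powr (- Complex a t))) sums Re (mangoldt_ser (Complex a t))"
    using assms by (intro sums_Re mangoldt_ser_sums) auto
  also have "(\<lambda>n. Re (mangoldt n * of_nat n powr (- Complex a t))) = (\<lambda>n. mangoldt n * real n powr (-a) * cos (t * ln (real n)))"
  proof
    fix n show "Re (mangoldt n * of_nat n powr (- Complex a t)) = mangoldt n * real n powr (-a) * cos (t * ln (real n))"
      by (cases "n = 0") (auto simp: of_nat_powr_polar)
  qed
  finally show ?thesis .
qed

lemma Re_mangoldt_ser_order:
  obtains k :: nat where 
    "((\<lambda>x::real. x * Re (mangoldt_ser (Complex (1 + x) t))) \<longlongrightarrow> (if t = 0 then 1 else 0) - real k) (at_right 0)"
    "zeta_reg (Complex 1 t) = 0 \<Longrightarrow> k > 0"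
proof -
  obtain k where k: "((\<lambda>x::real. of_real x * mangoldt_ser (Complex 1 t + of_real x)) \<longlongrightarrow> 
      (if Complex 1 t = 1 then 1 else 0) - of_nat k) (at_right 0)"
     "zeta_reg (Complex 1 t) = 0 \<Longrightarrow> k > 0"
    by (rule mangoldt_ser_order[of "Complex 1 t"]) auto
  have "Complex 1 t + of_real x = Complex (1 + x) t" for x by (simp add: complex_eq_iff)
  hence "((\<lambda>x::real. x * Re (mangoldt_ser (Complex (1 + x) t))) \<longlongrightarrow> 
     Re ((if Complex 1 t = 1 then 1 else 0) - of_nat k)) (at_right 0)"
    using tendsto_Re[OF k(1)] by simp
  moreover have "Complex 1 t = 1 \<longleftrightarrow> t = 0" by (simp add: complex_eq_iff)
  ultimately show ?thesis using that[of k] k(2) by (auto split: if_splits)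
qed

text \<open>To the right of the line \<open>Re s = 1\<close> the von Mangoldt series is bounded near \<open>s\<close>, which excludes a
zero. On the line, \<open>zeta_reg 1 = 1\<close>, and a zero of order \<open>k\<close> at \<open>1 + t * \<i>\<close> with \<open>t \<noteq> 0\<close> is excluded by
the inequality \<open>3 + 4 * cos x + cos (2 * x) \<ge> 0\<close>, which yields \<open>3 - 4 * k \<ge> 0\<close>.\<close>

lemma zeta_reg_nonzero:
  assumes "Re s \<ge> 1"
  shows "zeta_reg s \<noteq> 0"
proof (cases "Re s > 1")
  case True
  obtain k :: nat where k: "((\<lambda>x::real. of_real x * mangoldt_ser (s + of_real x)) \<longlongrightarrow> 
      (if s = 1 then 1 else 0) - of_nat k) (at_right 0)" "zeta_reg s = 0 \<Longrightarrow> k > 0"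
    by (rule mangoldt_ser_order[OF assms], rule that, assumption, simp)
  define B where "B = (\<Sum>n. mangoldt n * real n powr (- Re s))"
  have B: "norm (mangoldt_ser (s + of_real x)) \<le> B" if "x > 0" for x
    unfolding mangoldt_ser_def B_def
  proof (rule norm_suminf_le[OF _ summable_mangoldt[OF True]])
    fix n
    have "real n powr (- Re s - x) \<le> real n powr (- Re s)"
      using that by (cases "n = 0") (auto intro!: powr_mono)
    thus "norm (mangoldt n * of_nat n powr (- (s + of_real x)) :: complex) \<le> mangoldt n * real n powr - Re s"
      by (simp add: norm_mult norm_of_nat_powr mangoldt_nonneg mult_left_mono)
  qed
  have "((\<lambda>x::real. of_real x * mangoldt_ser (s + of_real x)) \<longlongrightarrow> 0) (at_right 0)"
  proof (rule Lim_null_comparison)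
    show "\<forall>\<^sub>F x in at_right 0. norm (of_real x * mangoldt_ser (s + of_real x)) \<le> x * B"
      using eventually_at_right_less[of 0]
      by eventually_elim (use B in \<open>auto simp: norm_mult intro!: mult_left_mono\<close>)
    show "((\<lambda>x. x * B) \<longlongrightarrow> 0) (at_right 0)" by (auto intro!: tendsto_eq_intros)
  qed
  moreover have "s \<noteq> 1" using True by auto
  with k(1) have "((\<lambda>x::real. of_real x * mangoldt_ser (s + of_real x)) \<longlongrightarrow> - of_nat k) (at_right 0)"
    by simp
  ultimately have "- of_nat k = (0 :: complex)"
    by (rule tendsto_unique[OF trivial_limit_at_right_real, rotated])
  thus ?thesis using k(2) by auto
next
  case False
  define t where "t = Im s"
  have s: "s = Complex 1 t" using False assms by (auto simp: t_def complex_eq_iff)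
  show ?thesis
  proof (cases "t = 0")
    case True
    hence "s = 1" using s by (auto simp: complex_eq_iff)
    thus ?thesis by (simp add: zeta_reg_1)
  next
    case False
    let ?L = "\<lambda>t x. Re (mangoldt_ser (Complex (1 + x) t))"
    obtain k0 where k0: "((\<lambda>x. x * ?L 0 x) \<longlongrightarrow> 1 - real k0) (at_right 0)"
      by (rule Re_mangoldt_ser_order[of 0]) simp
    obtain k where k: "((\<lambda>x. x * ?L t x) \<longlongrightarrow> - real k) (at_right 0)" "zeta_reg s = 0 \<Longrightarrow> k > 0"
      by (rule Re_mangoldt_ser_order[of t]) (use False s in simp)
    obtain k2 where k2: "((\<lambda>x. x * ?L (2 * t) x) \<longlongrightarrow> - real k2) (at_right 0)"
      by (rule Re_mangoldt_ser_order[of "2 * t"]) (use False in simp)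
    have "((\<lambda>x. 3 * (x * ?L 0 x) + 4 * (x * ?L t x) + x * ?L (2 * t) x) \<longlongrightarrow> 
        3 * (1 - real k0) + 4 * (- real k) + (- real k2)) (at_right 0)"
      by (intro tendsto_intros k0 k k2)
    moreover have "\<forall>\<^sub>F x in at_right 0. 0 \<le> 3 * (x * ?L 0 x) + 4 * (x * ?L t x) + x * ?L (2 * t) x"
      using eventually_at_right_less[of 0]
    proof eventually_elim
      case (elim x)
      have a: "1 + x > 1" using elim by simp
      have "(\<lambda>n. 3 * (mangoldt n * real n powr (-(1+x)) * cos (0 * ln (real n))) +
             4 * (mangoldt n * real n powr (-(1+x)) * cos (t * ln (real n))) +
             mangoldt n * real n powr (-(1+x)) * cos ((2*t) * ln (real n))) sums
             (3 * ?L 0 x + 4 * ?L t x + ?L (2 * t) x)"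
        by (intro sums_add sums_mult Re_mangoldt_ser_sums a)
      moreover have "0 \<le> 3 * (mangoldt n * real n powr (-(1+x)) * cos (0 * ln (real n))) +
             4 * (mangoldt n * real n powr (-(1+x)) * cos (t * ln (real n))) +
             mangoldt n * real n powr (-(1+x)) * cos ((2*t) * ln (real n))" for n
      proof -
        define c where "c = cos (t * ln (real n))"
        define W where "W = mangoldt n * real n powr (-(1+x))"
        have e: "cos ((2*t) * ln (real n)) = 2 * c\<^sup>2 - 1"
          using cos_double_cos[of "t * ln (real n)"] by (simp only: c_def mult.assoc)
        have "3 * (W * cos (0 * ln (real n))) + 4 * (W * c) + W * (2 * c\<^sup>2 - 1) = W * (2 * (1 + c)\<^sup>2)"
          by (simp add: power2_eq_square algebra_simps)
        hence "3 * (mangoldt n * real n powr (-(1+x)) * cos (0 * ln (real n))) +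
             4 * (mangoldt n * real n powr (-(1+x)) * cos (t * ln (real n))) +
             mangoldt n * real n powr (-(1+x)) * cos ((2*t) * ln (real n))
             = mangoldt n * real n powr (-(1+x)) * (2 * (1 + c)\<^sup>2)"
          unfolding e c_def W_def .
        also have "\<dots> \<ge> 0" by (intro mult_nonneg_nonneg mangoldt_nonneg) auto
        finally show ?thesis .
      qed
      ultimately have "0 \<le> 3 * ?L 0 x + 4 * ?L t x + ?L (2 * t) x"
        by (rule sums_le[OF _ sums_zero, rotated])
      hence "0 \<le> x * (3 * ?L 0 x + 4 * ?L t x + ?L (2 * t) x)" using elim by simp
      thus ?case by (simp add: algebra_simps)
    qed
    ultimately have "0 \<le> 3 * (1 - real k0) + 4 * (- real k) + (- real k2)"
      by (rule tendsto_lowerbound) auto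
    hence "k = 0" by (cases k) auto
    thus ?thesis using k(2) by auto
  qed
qed

section \<open>Fejer smoothing of Dirichlet series\<close>

text \<open>The Fejer kernel, up to scaling: the Fourier transform of the tent function \<open>1 - \<bar>t\<bar>\<close> on
\<open>{-1..1}\<close>.\<close>

definition fejer :: "real \<Rightarrow> real" where
  "fejer u = (if u = 0 then 1 else 2 * (1 - cos u) / u\<^sup>2)"

lemma fejer_alt: "u \<noteq> 0 \<Longrightarrow> fejer u = (sin (u / 2) / (u / 2))\<^sup>2"
  using cos_double_sin[of "u / 2"] by (simp add: fejer_def field_simps power2_eq_square)

lemma fejer_nonneg: "fejer u \<ge> 0"
  by (simp add: fejer_def)

lemma fejer_le_1: "fejer u \<le> 1"
proof (cases "u = 0")
  case False
  have "\<bar>sin (u / 2) / (u / 2)\<bar> \<le> 1"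
    using abs_sin_x_le_abs_x[of "u / 2"] False by (simp add: divide_simps)
  hence "(sin (u / 2) / (u / 2))\<^sup>2 \<le> 1\<^sup>2" by (simp add: abs_le_square_iff[symmetric] del: power_one)
  thus ?thesis using False by (simp add: fejer_alt)
qed (simp add: fejer_def)

lemma fejer_le: "u \<noteq> 0 \<Longrightarrow> fejer u \<le> 4 / u\<^sup>2"
  using divide_right_mono[of "2 * (1 - cos u)" 4 "u\<^sup>2"] cos_ge_minus_one[of u] by (simp add: fejer_def)

lemma fejer_ge_quarter:
  assumes "\<bar>u\<bar> \<le> 1"
  shows "fejer u \<ge> 1 / 4"
proof (cases "u = 0")
  case False
  define x where "x = \<bar>u\<bar> / 2"
  have x: "0 < x" "x \<le> 1 / 2" using assms False by (auto simp: x_def)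
  have "\<exists>z. 0 < z \<and> z < x \<and> sin x - sin 0 = (x - 0) * cos z"
    by (rule MVT2[OF x(1)]) auto
  then obtain z where z: "0 < z" "z < x" "sin x = x * cos z" by auto
  have "cos (pi / 3) \<le> cos z"
    using z x pi_gt3 by (intro cos_monotone_0_pi_le) auto
  hence "1 / 2 \<le> sin x / x" using z x by (simp add: cos_60)
  hence "(1 / 2)\<^sup>2 \<le> (sin x / x)\<^sup>2" by (intro power_mono) auto
  also have "(sin x / x)\<^sup>2 = fejer u"
    using False by (cases "u > 0") (auto simp: x_def fejer_alt)
  finally show ?thesis by (simp add: power2_eq_square)
qed (simp add: fejer_def)

lemma fejer_has_integral:
  assumes "l > 0"
  shows "((\<lambda>t. (1 - t / l) * cos (t * u)) has_integral (l / 2 * fejer (l * u))) {0..l}"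
proof (cases "u = 0")
  case True
  have "((\<lambda>t. 1 - t / l) has_integral ((l - l\<^sup>2 / (2 * l)) - (0 - 0\<^sup>2 / (2 * l)))) {0..l}"
    using assms by (intro fundamental_theorem_of_calculus)
      (auto intro!: derivative_eq_intros simp: has_real_derivative_iff_has_vector_derivative[symmetric])
  thus ?thesis using True assms by (simp add: fejer_def power2_eq_square)
next
  case False
  define F where "F t = (1 - t / l) * (sin (t * u) / u) - cos (t * u) / (l * u\<^sup>2)" for t
  have "((\<lambda>t. (1 - t / l) * cos (t * u)) has_integral (F l - F 0)) {0..l}"
  proof (rule fundamental_theorem_of_calculus)
    fix t assume "t \<in> {0..l}"
    have "(F has_real_derivative (1 - t / l) * cos (t * u)) (at t within {0..l})"
      unfolding F_def using assms False
      by (auto intro!: derivative_eq_intros simp: power2_eq_square field_simps)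
    thus "(F has_vector_derivative (1 - t / l) * cos (t * u)) (at t within {0..l})"
      by (simp add: has_real_derivative_iff_has_vector_derivative)
  qed (use assms in auto)
  also have "F l - F 0 = l / 2 * fejer (l * u)"
    using assms False by (simp add: F_def fejer_def field_simps power2_eq_square)
  finally show ?thesis .
qed

text \<open>A Fejer-weighted sum is an average of cosine sums over a bounded range of frequencies.\<close>

lemma fejer_sums:
  fixes b x :: "nat \<Rightarrow> real"
  assumes "l > 0" and sb: "summable (\<lambda>n. \<bar>b n\<bar>)"
  shows "(\<lambda>n. b n * (l / 2 * fejer (l * x n))) sums
           integral {0..l} (\<lambda>t. (1 - t / l) * (\<Sum>n. b n * cos (t * x n)))"
proof -
  define f where "f n t = (1 - t / l) * (b n * cos (t * x n))" for n t
  have nf: "norm (f n t) \<le> \<bar>b n\<bar>" if "t \<in> {0..l}" for n t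
  proof -
    have "\<bar>1 - t / l\<bar> \<le> 1" using that assms(1) by (auto simp: abs_if divide_simps)
    hence "\<bar>1 - t / l\<bar> * (\<bar>b n\<bar> * \<bar>cos (t * x n)\<bar>) \<le> 1 * (\<bar>b n\<bar> * 1)"
      by (intro mult_mono) auto
    thus ?thesis by (simp add: f_def abs_mult)
  qed
  have u: "uniform_limit {0..l} (\<lambda>N t. \<Sum>n<N. f n t) (\<lambda>t. \<Sum>n. f n t) sequentially"
    by (rule Weierstrass_m_test[OF nf sb])
  have c: "continuous_on {0..l} (\<lambda>t. \<Sum>n<N. f n t)" for N
    unfolding f_def using assms(1) by (intro continuous_intros) auto
  obtain I J where IJ: "\<And>N. ((\<lambda>t. \<Sum>n<N. f n t) has_integral I N) {0..l}"
      "((\<lambda>t. \<Sum>n. f n t) has_integral J) {0..l}" "I \<longlonglongrightarrow> J"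
    by (rule uniform_limit_integral[OF u c sequentially_bot]) (rule that; simp)
  have "I N = (\<Sum>n<N. b n * (l / 2 * fejer (l * x n)))" for N
  proof (rule has_integral_unique[OF IJ(1)])
    show "((\<lambda>t. \<Sum>n<N. f n t) has_integral (\<Sum>n<N. b n * (l / 2 * fejer (l * x n)))) {0..l}"
    proof (rule has_integral_sum)
      fix n
      have "((\<lambda>t. b n * ((1 - t / l) * cos (t * x n))) has_integral (b n * (l / 2 * fejer (l * x n)))) {0..l}"
        by (intro has_integral_mult_right fejer_has_integral assms)
      thus "(f n has_integral (b n * (l / 2 * fejer (l * x n)))) {0..l}"
        by (simp add: f_def[abs_def] mult_ac)
    qed auto
  qed
  hence "I = (\<lambda>N. \<Sum>n<N. b n * (l / 2 * fejer (l * x n)))" by (rule ext)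
  hence "(\<lambda>n. b n * (l / 2 * fejer (l * x n))) sums J"
    using IJ(3) unfolding sums_def by (simp only:)
  also have "J = integral {0..l} (\<lambda>t. \<Sum>n. f n t)" using IJ(2) by (simp add: integral_unique)
  also have "(\<lambda>t. \<Sum>n. f n t) = (\<lambda>t. (1 - t / l) * (\<Sum>n. b n * cos (t * x n)))"
  proof
    fix t
    have "summable (\<lambda>n. b n * cos (t * x n))"
    proof (rule summable_comparison_test[OF _ sb], intro exI[of _ 0] allI impI)
      fix n show "norm (b n * cos (t * x n)) \<le> \<bar>b n\<bar>"
        using mult_left_mono[OF abs_cos_le_one[of "t * x n"], of "\<bar>b n\<bar>"] by (simp add: abs_mult)
    qed
    thus "(\<Sum>n. f n t) = (1 - t / l) * (\<Sum>n. b n * cos (t * x n))"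
      unfolding f_def by (rule suminf_mult)
  qed
  finally show ?thesis .
qed

text \<open>Integration by parts against \<open>cis (t * y)\<close> gains a factor \<open>1 / y\<close>. The amplitude is the restriction
of a function of a complex variable, so that complex derivatives can be used.\<close>

lemma oscillatory_integral_bound:
  fixes P P' :: "complex \<Rightarrow> complex"
  assumes "l > 0" "y > 0"
    and P: "\<And>t. t \<in> {0..l} \<Longrightarrow> (P has_field_derivative P' (of_real t)) (at (of_real t))"
    and P': "continuous_on (of_real ` {0..l}) P'"
    and A: "norm (P 0) \<le> A" "norm (P (of_real l)) \<le> A"
    and B: "\<And>t. t \<in> {0..l} \<Longrightarrow> norm (P' (of_real t)) \<le> B"
  shows "norm (integral {0..l} (\<lambda>t. cis (t * y) * P (of_real t))) \<le> (2 * A + l * B) / y"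
proof -
  define F where "F z = exp (\<i> * of_real y * z) / (\<i> * of_real y) * P z" for z
  have cis: "exp (\<i> * of_real y * of_real t) = cis (t * y)" for t
    by (simp add: cis_conv_exp mult_ac)
  have nF: "norm (F (of_real t)) = norm (P (of_real t)) / y" for t
    unfolding F_def cis using assms(2) by (simp add: norm_mult norm_divide)
  have FI: "((\<lambda>t. cis (t * y) * P (of_real t) + cis (t * y) / (\<i> * of_real y) * P' (of_real t)) has_integral
         (F (of_real l) - F (of_real 0))) {0..l}"
  proof (rule fundamental_theorem_of_calculus)
    fix t assume t: "t \<in> {0..l}"
    have "(F has_field_derivative exp (\<i> * of_real y * of_real t) * P (of_real t) + 
        exp (\<i> * of_real y * of_real t) / (\<i> * of_real y) * P' (of_real t)) (at (of_real t))"
      unfolding F_def using assms(2)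
      by (auto intro!: derivative_eq_intros P[OF t] simp: field_simps)
    thus "((\<lambda>t. F (of_real t)) has_vector_derivative 
        cis (t * y) * P (of_real t) + cis (t * y) / (\<i> * of_real y) * P' (of_real t)) (at t within {0..l})"
      unfolding cis by (rule has_vector_derivative_real_field)
  qed (use assms in auto)
  have c': "continuous_on {0..l} (\<lambda>t. P' (of_real t))"
    using P' by (intro continuous_on_compose2[OF P']) (auto intro!: continuous_intros)
  have c: "continuous_on {0..l} (\<lambda>t. cis (t * y) / (\<i> * of_real y) * P' (of_real t))"
    by (intro continuous_intros c') (use assms in auto)
  define J where "J = integral {0..l} (\<lambda>t. cis (t * y) / (\<i> * of_real y) * P' (of_real t))"
  have J: "((\<lambda>t. cis (t * y) / (\<i> * of_real y) * P' (of_real t)) has_integral J) {0..l}"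
    unfolding J_def by (intro integrable_integral integrable_continuous_interval c)
  from has_integral_diff[OF FI J]
  have "((\<lambda>t. cis (t * y) * P (of_real t)) has_integral (F (of_real l) - F (of_real 0) - J)) {0..l}"
    by simp
  hence eq: "integral {0..l} (\<lambda>t. cis (t * y) * P (of_real t)) = F (of_real l) - F (of_real 0) - J"
    by (rule integral_unique)
  have "norm (F (of_real l) - F (of_real 0) - J) \<le> norm (F (of_real l)) + norm (F (of_real 0)) + norm J"
    using norm_triangle_ineq4[of "F (of_real l) - F (of_real 0)" J] norm_triangle_ineq4[of "F (of_real l)" "F (of_real 0)"]
    by linarith
  moreover have "norm J \<le> B / y * (l - 0)" unfolding J_def
  proof (rule integral_bound[OF _ c])
    show "norm (cis (t * y) / (\<i> * of_real y) * P' (of_real t)) \<le> B / y" if "t \<in> {0..l}" for t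
      using B[OF that] assms by (simp add: norm_mult norm_divide divide_right_mono)
  qed (use assms in auto)
  moreover have "norm (F (of_real l)) \<le> A / y" unfolding nF using A assms by (simp add: divide_right_mono)
  moreover have "norm (F (of_real 0)) \<le> A / y" unfolding nF using A assms by (simp add: divide_right_mono)
  ultimately have "norm (F (of_real l) - F (of_real 0) - J) \<le> A / y + A / y + B / y * (l - 0)"
    by linarith
  also have "A / y + A / y + B / y * (l - 0) = (2 * A + l * B) / y" by (simp add: add_divide_distrib mult_ac)
  finally show ?thesis unfolding eq .
qed

text \<open>The poles at \<open>s = 1\<close> cancel in the difference of the two Dirichlet series, and \<open>zeta_reg\<close> has no
zeros with \<open>Re s \<ge> 1\<close>, so the difference extends holomorphically across the line \<open>Re s = 1\<close>.\<close>

lemma mangoldt_zeta_extension: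
  "\<exists>G U. open U \<and> {s. Re s \<ge> 1} \<subseteq> U \<and> G holomorphic_on U \<and>
     (\<forall>s. Re s > 1 \<longrightarrow> G s = mangoldt_ser s - zeta_ser s)"
proof -
  define S where "S = {s. Re s > 0}"
  have S: "open S" unfolding S_def by (rule open_halfspace_Re_gt)
  note hol = zeta_reg_holomorphic[folded S_def]
  define U where "U = S \<inter> zeta_reg -` (-{0})"
  have U: "open U" unfolding U_def
    using hol S by (intro continuous_open_preimage holomorphic_on_imp_continuous_on) auto
  define E where "E = (\<lambda>z. if z = 1 then deriv zeta_reg 1 else zeta_reg z / (z - 1) - zeta_reg 1 / (z - 1))"
  have E: "E holomorphic_on S" unfolding E_def
    by (rule pole_theorem_open[OF hol S]) auto
  \<comment> \<open>For \<open>Re s > 1\<close>, \<open>G s\<close> is \<open>(1 / (s - 1) - zeta_reg' s / zeta_reg s) - zeta_reg s / (s - 1)\<close>.\<close>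
  define G where "G s = - deriv zeta_reg s / zeta_reg s - E s" for s
  have "deriv zeta_reg holomorphic_on S" using hol S by (rule holomorphic_deriv)
  hence h1: "deriv zeta_reg holomorphic_on U" by (rule holomorphic_on_subset) (auto simp: U_def)
  have h2: "zeta_reg holomorphic_on U" using hol by (rule holomorphic_on_subset) (auto simp: U_def)
  have h3: "E holomorphic_on U" using E by (rule holomorphic_on_subset) (auto simp: U_def)
  have "G holomorphic_on U" unfolding G_def
    by (intro holomorphic_on_diff holomorphic_on_divide holomorphic_on_minus h1 h2 h3) (auto simp: U_def)
  moreover have "{s. Re s \<ge> 1} \<subseteq> U" using zeta_reg_nonzero by (auto simp: U_def S_def)
  moreover have "G s = mangoldt_ser s - zeta_ser s" if "Re s > 1" for s
  proof -
    have "zeta_reg s \<noteq> 0" "s \<noteq> 1" using zeta_reg_nonzero[of s] that by auto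
    thus ?thesis using that
      by (simp add: G_def E_def mangoldt_ser_eq zeta_reg_1) (simp add: zeta_reg_eq divide_simps)
  qed
  ultimately show ?thesis using U by blast
qed

text \<open>The tauberian core: after Fejer smoothing around \<open>ln n = y\<close>, the weights \<open>\<Lambda>(n) / n\<close> and \<open>1 / n\<close> differ
by \<open>O(1 / y)\<close>, uniformly in the regularising exponent \<open>\<sigma>\<close>. The kernel only sees the difference of the
Dirichlet series on the segments \<open>{1 + \<sigma> + t * \<i> | 0 \<le> t \<le> l}\<close>, where the holomorphic extension and its
derivative are bounded.\<close>

lemma smoothed_difference_bound:
  assumes l: "l > 0"
  shows "\<exists>C\<ge>0. \<forall>\<sigma> y. 0 < \<sigma> \<longrightarrow> \<sigma> \<le> 1 \<longrightarrow> y > 0 \<longrightarrow>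
    \<bar>\<Sum>n. (mangoldt n - 1) * real n powr (-(1 + \<sigma>)) * fejer (l * (ln (real n) - y))\<bar> \<le> C / y"
proof -
  obtain G U where G: "open U" "{s. Re s \<ge> 1} \<subseteq> U" "G holomorphic_on U"
    and G_eq: "\<forall>s. Re s > 1 \<longrightarrow> G s = mangoldt_ser s - zeta_ser s"
    using mangoldt_zeta_extension by (elim exE conjE)
  define D where "D = cbox (Complex 1 0) (Complex 2 l)"
  have D: "D \<subseteq> U" using G(2) by (auto simp: D_def in_cbox_complex_iff)
  have DI: "Complex (1 + \<sigma>) t \<in> D" if "\<sigma> \<in> {0..1}" "t \<in> {0..l}" for \<sigma> t
    using that by (auto simp: D_def in_cbox_complex_iff)
  have "bounded (G ` D)" 
    unfolding D_def using D G
    by (intro compact_imp_bounded compact_continuous_image holomorphic_on_imp_continuous_on)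
       (auto intro: holomorphic_on_subset simp: D_def)
  then obtain M1 where M1: "M1 > 0" "\<And>s. s \<in> D \<Longrightarrow> norm (G s) \<le> M1"
    unfolding bounded_pos by auto
  have G': "deriv G holomorphic_on U" using G by (intro holomorphic_deriv) auto
  have "bounded (deriv G ` D)" 
    unfolding D_def using D G'
    by (intro compact_imp_bounded compact_continuous_image holomorphic_on_imp_continuous_on)
       (auto intro: holomorphic_on_subset simp: D_def)
  then obtain M2 where M2: "M2 > 0" "\<And>s. s \<in> D \<Longrightarrow> norm (deriv G s) \<le> M2"
    unfolding bounded_pos by auto
  define C where "C = 2 / l * (2 * M1 + l * (M1 / l + M2))"
  show ?thesis
  proof (intro exI[of _ C] conjI allI impI)
    show "C \<ge> 0" using l M1 M2 by (simp add: C_def)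
  next
    fix \<sigma> y :: real assume \<sigma>: "0 < \<sigma>" "\<sigma> \<le> 1" and y: "y > 0"
    define b where "b n = (mangoldt n - 1) * real n powr (-(1 + \<sigma>))" for n
    have b: "summable (\<lambda>n. \<bar>b n\<bar>)"
    proof (rule summable_comparison_test)
      show "summable (\<lambda>n. mangoldt n * real n powr (-(1 + \<sigma>)) + real n powr (-(1 + \<sigma>)))"
        using \<sigma> by (intro summable_add summable_mangoldt summable_real_powr) auto
      have "norm \<bar>b n\<bar> \<le> mangoldt n * real n powr (-(1 + \<sigma>)) + real n powr (-(1 + \<sigma>))" for n
      proof -
        have "\<bar>mangoldt n - 1\<bar> \<le> mangoldt n + (1::real)" using mangoldt_nonneg[of n] by auto
        from mult_right_mono[OF this, of "real n powr (-(1 + \<sigma>))"] show ?thesis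
          unfolding b_def real_norm_def abs_mult abs_abs distrib_right by simp
      qed
      thus "\<exists>N. \<forall>n\<ge>N. norm \<bar>b n\<bar> \<le> mangoldt n * real n powr (-(1 + \<sigma>)) + real n powr (-(1 + \<sigma>))" by blast
    qed
    \<comment> \<open>At real \<open>t\<close>, \<open>P t\<close> is the tent weight times the extension at \<open>1 + \<sigma> + t * \<i>\<close>.\<close>
    define P where "P z = (1 - z / of_real l) * G (of_real (1 + \<sigma>) + \<i> * z)" for z
    define P' where "P' z = - G (of_real (1 + \<sigma>) + \<i> * z) / of_real l + 
       (1 - z / of_real l) * (\<i> * deriv G (of_real (1 + \<sigma>) + \<i> * z))" for z
    have sz: "of_real (1 + \<sigma>) + \<i> * of_real t = Complex (1 + \<sigma>) t" for t
      by (simp add: complex_eq_iff)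
    have inD: "of_real (1 + \<sigma>) + \<i> * of_real t \<in> D" if "t \<in> {0..l}" for t
      unfolding sz using \<sigma> that by (intro DI) auto
    have csum: "(\<Sum>n. b n * cos (t * (ln (real n) - y))) = Re (cis (t * y) * G (Complex (1 + \<sigma>) t))" for t
    proof -
      define s where "s = Complex (1 + \<sigma>) t"
      have s: "Re s > 1" using \<sigma> by (auto simp: s_def)
      have "(\<lambda>n. of_nat n powr (-s)) sums zeta_ser s"
        using summable_zeta_ser[OF s] unfolding zeta_ser_def
        by (intro summable_sums summable_norm_cancel[of "\<lambda>n. of_nat n powr (-s)"])
      from sums_mult[OF sums_diff[OF mangoldt_ser_sums[OF s] this], of "cis (t * y)"]
      have "(\<lambda>n. Re (cis (t * y) * (mangoldt n * of_nat n powr (-s) - of_nat n powr (-s)))) sums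
              Re (cis (t * y) * G s)" using G_eq s by (intro sums_Re) simp
      also have "(\<lambda>n. Re (cis (t * y) * (mangoldt n * of_nat n powr (-s) - of_nat n powr (-s)))) =
          (\<lambda>n. b n * cos (t * (ln (real n) - y)))"
      proof
        fix n :: nat
        show "Re (cis (t * y) * (mangoldt n * of_nat n powr (-s) - of_nat n powr (-s))) = b n * cos (t * (ln (real n) - y))"
        proof (cases "n = 0")
          case False
          have "(mangoldt n * of_nat n powr (-s) - of_nat n powr (-s)) =
             of_real (b n) * cis (- (t * ln (real n)))"
            using False unfolding s_def
            by (simp add: of_nat_powr_polar b_def left_diff_distrib)
          hence "cis (t * y) * (mangoldt n * of_nat n powr (-s) - of_nat n powr (-s)) =
             of_real (b n) * cis (t * y - t * ln (real n))"
            by (simp add: cis_mult algebra_simps flip: cis_divide)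
          also have "Re \<dots> = b n * cos (t * y - t * ln (real n))" by simp
          also have "cos (t * y - t * ln (real n)) = cos (t * (ln (real n) - y))"
            using cos_minus[of "t * y - t * ln (real n)"] by (simp add: algebra_simps)
          finally show ?thesis .
        qed (auto simp: b_def)
      qed
      finally show ?thesis by (simp add: sums_iff s_def)
    qed
    have hd: "((\<lambda>z. G (of_real (1 + \<sigma>) + \<i> * z)) has_field_derivative \<i> * deriv G (of_real (1 + \<sigma>) + \<i> * of_real t)) (at (of_real t))"
      if t: "t \<in> {0..l}" for t
    proof -
      have "(G has_field_derivative deriv G (of_real (1 + \<sigma>) + \<i> * of_real t)) (at (of_real (1 + \<sigma>) + \<i> * of_real t))"
        using inD[OF t] D by (intro holomorphic_derivI[OF G(3,1)]) auto
      moreover have "((\<lambda>z. of_real (1 + \<sigma>) + \<i> * z) has_field_derivative \<i>) (at (of_real t))"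
        by (auto intro!: derivative_eq_intros)
      ultimately show ?thesis
        using DERIV_chain2[of G "deriv G (of_real (1 + \<sigma>) + \<i> * of_real t)" "\<lambda>z. of_real (1 + \<sigma>) + \<i> * z" "of_real t" \<i> UNIV]
        by (simp only: mult.commute[of \<i>])
    qed
    have dP: "(P has_field_derivative P' (of_real t)) (at (of_real t))" if t: "t \<in> {0..l}" for t
    proof -
      have "((\<lambda>z. 1 - z / of_real l) has_field_derivative - (1 / of_real l)) (at (of_real t :: complex))"
        using l by (auto intro!: derivative_eq_intros)
      from DERIV_mult[OF this hd[OF t]] show ?thesis
        unfolding P_def[abs_def] P'_def by (simp add: mult_ac del: of_real_add)
    qed
    have cI: "continuous_on {0..l} (\<lambda>t. P (of_real t))"
    proof (intro continuous_at_imp_continuous_on ballI)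
      fix t assume t: "t \<in> {0..l}"
      have "isCont P (of_real t)" using dP[OF t] by (rule DERIV_isCont)
      thus "isCont (\<lambda>t. P (of_real t)) t" by (rule isCont_o2[rotated]) simp
    qed
    have bd: "norm (integral {0..l} (\<lambda>t. cis (t * y) * P (of_real t))) \<le> (2 * M1 + l * (M1 / l + M2)) / y"
    proof (rule oscillatory_integral_bound[OF l y dP])
      have i: "continuous_on (of_real ` {0..l}) (\<lambda>z. of_real (1 + \<sigma>) + \<i> * z)" by (intro continuous_intros)
      have im: "(\<lambda>z. of_real (1 + \<sigma>) + \<i> * z) ` (of_real ` {0..l}) \<subseteq> U" using inD D by auto
      show "continuous_on (of_real ` {0..l}) P'" unfolding P'_def using l
        by (intro continuous_intros continuous_on_compose2[OF holomorphic_on_imp_continuous_on[OF G(3)] i im]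
             continuous_on_compose2[OF holomorphic_on_imp_continuous_on[OF G'] i im]) auto
      show "norm (P 0) \<le> M1" using M1(2)[OF inD[of 0]] l by (simp add: P_def)
      show "norm (P (of_real l)) \<le> M1" using M1(1) l by (simp add: P_def)
      fix t assume t: "t \<in> {0..l}"
      have "norm (1 - of_real t / of_real l :: complex) = \<bar>1 - t / l\<bar>"
        by (metis norm_of_real of_real_1 of_real_diff of_real_divide)
      also have "\<dots> \<le> 1" using t l by (auto simp: abs_if divide_simps)
      finally have n1: "norm (1 - of_real t / of_real l :: complex) \<le> 1" .
      have "norm (P' (of_real t)) \<le> norm (- G (of_real (1 + \<sigma>) + \<i> * of_real t) / of_real l) +
          norm ((1 - of_real t / of_real l) * (\<i> * deriv G (of_real (1 + \<sigma>) + \<i> * of_real t)))"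
        unfolding P'_def by (rule norm_triangle_ineq)
      also have "\<dots> \<le> M1 / l + 1 * M2"
        unfolding norm_mult norm_divide norm_minus_cancel using M1(2)[OF inD[OF t]] M2(2)[OF inD[OF t]] l n1
        by (intro add_mono mult_mono) (auto intro!: divide_right_mono)
      finally show "norm (P' (of_real t)) \<le> M1 / l + M2" by simp
    qed
    have "(\<lambda>n. b n * (l / 2 * fejer (l * (ln (real n) - y)))) sums
           integral {0..l} (\<lambda>t. (1 - t / l) * (\<Sum>n. b n * cos (t * (ln (real n) - y))))"
      by (rule fejer_sums[OF l b])
    also have "(\<lambda>t. (1 - t / l) * (\<Sum>n. b n * cos (t * (ln (real n) - y)))) = (\<lambda>t. Re (cis (t * y) * P (of_real t)))"
    proof
      fix t
      have "cis (t * y) * P (of_real t) = of_real (1 - t / l) * (cis (t * y) * G (Complex (1 + \<sigma>) t))"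
        unfolding P_def sz by (simp add: mult_ac)
      hence "Re (cis (t * y) * P (of_real t)) = (1 - t / l) * Re (cis (t * y) * G (Complex (1 + \<sigma>) t))"
        by (simp only: Re_complex_of_real Im_complex_of_real times_complex.sel mult_zero_left diff_zero)
      thus "(1 - t / l) * (\<Sum>n. b n * cos (t * (ln (real n) - y))) = Re (cis (t * y) * P (of_real t))"
        unfolding csum by simp
    qed
    also have "integral {0..l} (\<lambda>t. Re (cis (t * y) * P (of_real t))) = Re (integral {0..l} (\<lambda>t. cis (t * y) * P (of_real t)))"
      by (intro integral_linear[OF _ bounded_linear_Re, unfolded o_def] integrable_continuous_interval continuous_intros cI)
    finally have sums: "(\<lambda>n. b n * (l / 2 * fejer (l * (ln (real n) - y)))) sums
        Re (integral {0..l} (\<lambda>t. cis (t * y) * P (of_real t)))" .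
    have "(\<Sum>n. b n * fejer (l * (ln (real n) - y))) = 2 / l * Re (integral {0..l} (\<lambda>t. cis (t * y) * P (of_real t)))"
      using sums_mult[OF sums, of "2 / l"] l by (simp add: sums_iff mult_ac)
    also have "\<bar>\<dots>\<bar> \<le> 2 / l * ((2 * M1 + l * (M1 / l + M2)) / y)"
      using abs_Re_le_cmod[of "integral {0..l} (\<lambda>t. cis (t * y) * P (of_real t))"] bd l
      unfolding abs_mult by (intro mult_mono) auto
    finally show "\<bar>\<Sum>n. (mangoldt n - 1) * real n powr (-(1 + \<sigma>)) * fejer (l * (ln (real n) - y))\<bar> \<le> C / y"
      by (simp add: b_def C_def)
  qed
qed

section \<open>Means over logarithmic windows\<close>

text \<open>Positive integers are sorted into blocks by the integer part of their logarithm.\<close>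

definition log_block :: "nat \<Rightarrow> nat" where "log_block n = nat \<lfloor>ln (real n)\<rfloor>"

text \<open>The nonnegative weight \<open>a\<close> has total mass at most \<open>M\<close> on each block.\<close>

definition unit_mass_le :: "(nat \<Rightarrow> real) \<Rightarrow> real \<Rightarrow> bool" where
  "unit_mass_le a M \<longleftrightarrow> (\<forall>n. a n \<ge> 0) \<and> M \<ge> 0 \<and>
     (\<forall>j A. finite A \<longrightarrow> (\<forall>n\<in>A. n \<ge> 1 \<and> log_block n = j) \<longrightarrow> sum a A \<le> M)"

lemma unit_mass_leD:
  assumes "unit_mass_le a M" "finite S" "\<And>n. n \<in> S \<Longrightarrow> n \<ge> 1 \<and> log_block n = j"
  shows "sum a S \<le> M"
  using assms(1)[unfolded unit_mass_le_def, THEN conjunct2, THEN conjunct2, rule_format, OF assms(2,3)] .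

lemma sum_Un_le:
  fixes f :: "'a \<Rightarrow> real"
  assumes "finite A" "finite B" "\<And>x. f x \<ge> 0"
  shows "sum f (A \<union> B) \<le> sum f A + sum f B"
  using sum_Un[OF assms(1,2), of f] sum_nonneg[of "A \<inter> B" f] assms(3) by simp

lemma sum_inverse_squares_le: "(\<Sum>m=1..N. 1 / (real m)\<^sup>2) \<le> 2"
proof (cases "N = 0")
  case False
  have "(\<Sum>m=1..N. 1 / (real m)\<^sup>2) \<le> 2 - 1 / real N" if "N \<ge> 1"
    using that
  proof (induction N rule: dec_induct)
    case (step n)
    have "1 / (real (Suc n))\<^sup>2 \<le> 1 / (real n * real (Suc n))"
      using step by (intro divide_left_mono) (auto simp: power2_eq_square)
    also have "\<dots> = 1 / real n - 1 / real (Suc n)" using step by (simp add: field_simps)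
    finally show ?case using step by simp
  qed auto
  thus ?thesis using False by (smt (verit) divide_nonneg_nonneg less_one not_le of_nat_0_le_iff)
qed auto

lemma log_block_bounds:
  assumes "n \<ge> 1"
  shows "real (log_block n) \<le> ln (real n)" "ln (real n) < real (log_block n) + 1"
proof -
  have "ln (real n) \<ge> 0" using assms by simp
  thus "real (log_block n) \<le> ln (real n)" "ln (real n) < real (log_block n) + 1"
    unfolding log_block_def by linarith+
qed

text \<open>Upper bound for a Fejer-weighted sum. The three blocks around \<open>y\<close> are controlled by the bound \<open>B\<close>
for the kernel, the others by the quadratic decay of the kernel.\<close>

lemma fejer_mean_le:
  assumes a: "unit_mass_le a M" and A: "finite A" "\<And>n. n \<in> A \<Longrightarrow> n \<ge> 1"
    and l: "l > 0" and y: "y \<ge> 0" and B: "B \<ge> 0"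
    and near: "\<And>n. n \<in> A \<Longrightarrow> \<bar>ln (real n) - y\<bar> \<le> 2 \<Longrightarrow> fejer (l * (ln (real n) - y)) \<le> B"
  shows "(\<Sum>n\<in>A. a n * fejer (l * (ln (real n) - y))) \<le> 3 * M * B + 16 * M / l\<^sup>2"
proof -
  define J where "J = nat \<lfloor>y\<rfloor>"
  have J: "real J \<le> y" "y < real J + 1" using y unfolding J_def by linarith+
  have a0: "a n \<ge> 0" for n using a by (auto simp: unit_mass_le_def)
  have M0: "M \<ge> 0" using a by (auto simp: unit_mass_le_def)
  have mass: "sum a S \<le> M" if "S \<subseteq> A" "\<And>n. n \<in> S \<Longrightarrow> log_block n = j" for S j
  proof -
    have "finite S" using that A finite_subset by blast
    thus ?thesis by (rule unit_mass_leD[OF a, where j = j]) (use that A(2) in auto)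
  qed
  define d where "d n = nat \<bar>int (log_block n) - int J\<bar>" for n
  define A1 where "A1 = {n\<in>A. d n \<le> 1}"
  define A2 where "A2 = {n\<in>A. d n \<ge> 2}"
  define f where "f n = a n * fejer (l * (ln (real n) - y))" for n
  have "sum f A = sum f A1 + sum f A2"
    using A(1) by (subst sum.union_disjoint[symmetric]) (auto simp: A1_def A2_def intro!: sum.cong)
  moreover have "sum f A1 \<le> 3 * M * B"
  proof -
    have "sum f A1 \<le> (\<Sum>n\<in>A1. a n * B)"
    proof (rule sum_mono)
      fix n assume n: "n \<in> A1"
      have "\<bar>ln (real n) - y\<bar> \<le> 2"
        using log_block_bounds[of n] n A(2)[of n] J by (auto simp: A1_def d_def)
      thus "f n \<le> a n * B" unfolding f_def using n near[of n] a0 by (auto simp: A1_def intro!: mult_left_mono)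
    qed
    also have "\<dots> = sum a A1 * B" by (simp add: sum_distrib_right)
    also have "sum a A1 \<le> 3 * M"
    proof -
      let ?S = "\<lambda>j. {n\<in>A. log_block n = j}"
      have "sum a A1 \<le> sum a ((?S (J - 1) \<union> ?S J) \<union> ?S (J + 1))"
        using A(1) a0 by (intro sum_mono2) (auto simp: A1_def d_def)
      also have "\<dots> \<le> (sum a (?S (J - 1)) + sum a (?S J)) + sum a (?S (J + 1))"
        using A(1) a0 by (intro order_trans[OF sum_Un_le] add_mono order_refl sum_Un_le) auto
      also have "\<dots> \<le> (M + M) + M"
        by (intro add_mono mass) auto
      finally show ?thesis by simp
    qed
    finally show ?thesis using B by (simp add: mult_right_mono)
  qed
  moreover have "sum f A2 \<le> 16 * M / l\<^sup>2"
  proof -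
    define N where "N = Max (insert 0 ((\<lambda>n. d n - 1) ` A2))"
    have A2: "finite A2" using A(1) by (auto simp: A2_def)
    have "sum f A2 = (\<Sum>m\<in>{1..N}. \<Sum>n\<in>{n\<in>A2. d n - 1 = m}. f n)"
      using A2 by (intro sum.group[symmetric]) (auto simp: N_def A2_def intro!: Max_ge)
    \<comment> \<open>At most two blocks lie at distance \<open>m + 1\<close> from the block of \<open>y\<close>, and their points are at
    distance at least \<open>m\<close> from \<open>y\<close>.\<close>
    also have "\<dots> \<le> (\<Sum>m\<in>{1..N}. (8 * M / l\<^sup>2) * (1 / (real m)\<^sup>2))"
    proof (rule sum_mono)
      fix m assume m: "m \<in> {1..N}"
      have "(\<Sum>n\<in>{n\<in>A2. d n - 1 = m}. f n) \<le> (\<Sum>n\<in>{n\<in>A2. d n - 1 = m}. a n * (4 / (l * real m)\<^sup>2))"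
      proof (rule sum_mono)
        fix n assume n: "n \<in> {n\<in>A2. d n - 1 = m}"
        define u where "u = ln (real n) - y"
        have n1: "n \<ge> 1" using n A(2) by (auto simp: A2_def)
        have "\<bar>int (log_block n) - int J\<bar> = int m + 1" using n m by (auto simp: A2_def d_def)
        hence "\<bar>real (log_block n) - real J\<bar> = real m + 1" by linarith
        hence u: "\<bar>u\<bar> \<ge> real m"
          using log_block_bounds[OF n1] J unfolding u_def by linarith
        hence u0: "u \<noteq> 0" using m by auto
        have "fejer (l * u) \<le> 4 / (l * u)\<^sup>2" using u0 l by (intro fejer_le) auto
        also have "\<dots> \<le> 4 / (l * real m)\<^sup>2"
        proof (rule divide_left_mono)
          have "(real m)\<^sup>2 \<le> \<bar>u\<bar>\<^sup>2" using u by (intro power_mono) auto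
          thus "(l * real m)\<^sup>2 \<le> (l * u)\<^sup>2" by (simp add: power_mult_distrib mult_left_mono)
          show "0 < (l * u)\<^sup>2 * (l * real m)\<^sup>2" using u0 l m by simp
        qed simp
        finally show "f n \<le> a n * (4 / (l * real m)\<^sup>2)"
          unfolding f_def u_def using a0 by (intro mult_left_mono)
      qed
      also have "\<dots> = sum a {n\<in>A2. d n - 1 = m} * (4 / (l * real m)\<^sup>2)" by (simp only: sum_distrib_right)
      also have "\<dots> \<le> (2 * M) * (4 / (l * real m)\<^sup>2)"
      proof (rule mult_right_mono)
        let ?S = "\<lambda>j. {n\<in>A. log_block n = j}"
        have "sum a {n\<in>A2. d n - 1 = m} \<le> sum a (?S (J + m + 1) \<union> ?S (J - m - 1))"
          using A(1) a0 by (intro sum_mono2) (auto simp: A2_def d_def)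
        also have "\<dots> \<le> sum a (?S (J + m + 1)) + sum a (?S (J - m - 1))"
          using A(1) a0 by (intro sum_Un_le) auto
        also have "\<dots> \<le> M + M"
          by (intro add_mono mass) auto
        finally show "sum a {n\<in>A2. d n - 1 = m} \<le> 2 * M" by simp
      qed simp
      also have "\<dots> = (8 * M / l\<^sup>2) * (1 / (real m)\<^sup>2)" by (simp add: power_mult_distrib)
      finally show "(\<Sum>n\<in>{n\<in>A2. d n - 1 = m}. f n) \<le> (8 * M / l\<^sup>2) * (1 / (real m)\<^sup>2)" .
    qed
    also have "\<dots> = (8 * M / l\<^sup>2) * (\<Sum>m=1..N. 1 / (real m)\<^sup>2)" by (simp add: sum_distrib_left)
    also have "\<dots> \<le> (8 * M / l\<^sup>2) * 2" using M0 by (intro mult_left_mono sum_inverse_squares_le) auto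
    finally show ?thesis by simp
  qed
  ultimately show ?thesis unfolding f_def by linarith
qed

lemma powr_shift: "real n powr (-(1 + \<sigma>)) = real n powr (- \<sigma>) / real n"
  by (cases "n = 0") (simp_all add: powr_minus powr_add powr_diff field_simps)

lemma unit_mass_powr:
  assumes "\<sigma> \<ge> 0" "unit_mass_le (\<lambda>n. a n / real n) M" "\<And>n. a n \<ge> 0"
  shows "unit_mass_le (\<lambda>n. a n * real n powr (-(1 + \<sigma>))) M"
proof -
  have "a n * real n powr (-(1 + \<sigma>)) \<le> a n / real n" for n
  proof -
    have "real n powr (- \<sigma>) \<le> 1"
      using assms(1) powr_mono[of "- \<sigma>" 0 "real n"] by (cases "n = 0") auto
    hence "real n powr (-(1 + \<sigma>)) \<le> 1 / real n" unfolding powr_shift by (intro divide_right_mono) auto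
    from mult_left_mono[OF this assms(3)[of n]] show ?thesis by simp
  qed
  hence "sum (\<lambda>n. a n * real n powr (-(1 + \<sigma>))) A \<le> sum (\<lambda>n. a n / real n) A" for A
    by (intro sum_mono)
  thus ?thesis using assms unfolding unit_mass_le_def by (meson order_trans mult_nonneg_nonneg powr_ge_zero)
qed

lemma unit_mass_one: "unit_mass_le (\<lambda>n. 1 / real n) 3"
  unfolding unit_mass_le_def
proof (intro conjI allI impI)
  fix j :: nat and A :: "nat set" assume A: "finite A" "\<forall>n\<in>A. n \<ge> 1 \<and> log_block n = j"
  have b: "exp (real j) \<le> real n \<and> real n \<le> exp (real j + 1)" if "n \<in> A" for n
  proof -
    have "n \<ge> 1" "log_block n = j" using A that by auto
    with log_block_bounds[of n] show ?thesis
      by (metis exp_le_cancel_iff exp_ln less_eq_real_def of_nat_0_less_iff less_one not_le le_less_trans zero_less_one less_le_trans)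
  qed
  have "A \<subseteq> {1..nat \<lfloor>exp (real j + 1)\<rfloor>}"
  proof
    fix n assume "n \<in> A"
    with b[of n] A show "n \<in> {1..nat \<lfloor>exp (real j + 1)\<rfloor>}" by (auto simp: le_nat_floor)
  qed
  hence "card A \<le> card {1..nat \<lfloor>exp (real j + 1)\<rfloor>}" by (intro card_mono) auto
  hence c: "real (card A) \<le> exp (real j + 1)"
    using exp_ge_zero[of "real j + 1"] by (simp del: exp_ge_zero) linarith
  have "(\<Sum>n\<in>A. 1 / real n) \<le> (\<Sum>n\<in>A. exp (- real j))"
  proof (rule sum_mono)
    fix n assume n: "n \<in> A"
    have "n \<ge> 1" using A n by auto
    have "inverse (real n) \<le> inverse (exp (real j))" using b[OF n] by (intro le_imp_inverse_le) auto
    thus "1 / real n \<le> exp (- real j)" by (simp add: exp_minus inverse_eq_divide)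
  qed
  also have "\<dots> = real (card A) * exp (- real j)" by simp
  also have "\<dots> \<le> exp (real j + 1) * exp (- real j)" using c by (intro mult_right_mono) auto
  also have "\<dots> = exp 1" by (simp flip: exp_add)
  also have "\<dots> \<le> 3" by (rule exp_le)
  finally show "(\<Sum>n\<in>A. 1 / real n) \<le> 3" .
qed auto

text \<open>The Fejer mean of the weights \<open>a n / n\<close> at logarithmic scale \<open>1 / l\<close> around \<open>ln n = y\<close>, with
regularising exponent \<open>\<sigma> > 0\<close>. The index \<open>0\<close> contributes \<open>0\<close>.\<close>

definition fejer_mean :: "(nat \<Rightarrow> real) \<Rightarrow> real \<Rightarrow> real \<Rightarrow> real \<Rightarrow> real" where
  "fejer_mean a l \<sigma> y = (\<Sum>n. a n * real n powr (-(1 + \<sigma>)) * fejer (l * (ln (real n) - y)))"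

lemma summable_fejer_mean:
  assumes "summable (\<lambda>n. a n * real n powr (-(1 + \<sigma>)))" "\<And>n. a n \<ge> 0"
  shows "summable (\<lambda>n. a n * real n powr (-(1 + \<sigma>)) * fejer (x n))"
proof (rule summable_comparison_test[OF _ assms(1)], intro exI[of _ 0] allI impI)
  fix n
  have "a n * real n powr (-(1 + \<sigma>)) * fejer (x n) \<le> a n * real n powr (-(1 + \<sigma>)) * 1"
    using assms by (intro mult_left_mono fejer_le_1) auto
  thus "norm (a n * real n powr (-(1 + \<sigma>)) * fejer (x n)) \<le> a n * real n powr (-(1 + \<sigma>))"
    using assms fejer_nonneg by (simp add: abs_mult)
qed

lemma summable_fejer_mangoldt:
  "\<sigma> > 0 \<Longrightarrow> summable (\<lambda>n. mangoldt n * real n powr (-(1 + \<sigma>)) * fejer (x n))"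
  by (intro summable_fejer_mean summable_mangoldt mangoldt_nonneg) auto

lemma summable_fejer_one:
  "\<sigma> > 0 \<Longrightarrow> summable (\<lambda>n. 1 * real n powr (-(1 + \<sigma>)) * fejer (x n))"
  using summable_real_powr[of "-(1 + \<sigma>)"] by (intro summable_fejer_mean) auto

lemma fejer_mean_diff:
  assumes "l > 0"
  shows "\<exists>C\<ge>0. \<forall>\<sigma> y. 0 < \<sigma> \<longrightarrow> \<sigma> \<le> 1 \<longrightarrow> y > 0 \<longrightarrow>
    \<bar>fejer_mean mangoldt l \<sigma> y - fejer_mean (\<lambda>_. 1) l \<sigma> y\<bar> \<le> C / y"
proof -
  have "fejer_mean mangoldt l \<sigma> y - fejer_mean (\<lambda>_. 1) l \<sigma> y =
     (\<Sum>n. (mangoldt n - 1) * real n powr (-(1 + \<sigma>)) * fejer (l * (ln (real n) - y)))" if "\<sigma> > 0" for \<sigma> y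
    unfolding fejer_mean_def
    using suminf_diff[OF summable_fejer_mangoldt[OF that, of "\<lambda>n. l * (ln (real n) - y)"]
        summable_fejer_one[OF that, of "\<lambda>n. l * (ln (real n) - y)"]]
    by (simp add: algebra_simps)
  thus ?thesis using smoothed_difference_bound[OF assms] by simp
qed

lemma fejer_mean_one_le:
  assumes "l > 0" "\<sigma> > 0" "y \<ge> 0"
  shows "fejer_mean (\<lambda>_. 1) l \<sigma> y \<le> 9 + 48 / l\<^sup>2"
  unfolding fejer_mean_def
proof (rule suminf_le_const[OF summable_fejer_one[OF assms(2)]])
  fix N
  have "(\<Sum>n<N. 1 * real n powr (-(1 + \<sigma>)) * fejer (l * (ln (real n) - y))) =
        (\<Sum>n\<in>{1..<N}. 1 * real n powr (-(1 + \<sigma>)) * fejer (l * (ln (real n) - y)))"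
    by (rule sum.mono_neutral_right) (auto simp: Suc_le_eq)
  also have "\<dots> \<le> 3 * 3 * 1 + 16 * 3 / l\<^sup>2"
    using assms by (intro fejer_mean_le unit_mass_powr unit_mass_one fejer_le_1) auto
  finally show "(\<Sum>n<N. 1 * real n powr (-(1 + \<sigma>)) * fejer (l * (ln (real n) - y))) \<le> 9 + 48 / l\<^sup>2" by simp
qed

lemma powr_neg_ge:
  assumes "n \<ge> 1" "ln (real n) \<le> z" "\<sigma> \<ge> 0"
  shows "real n powr (-(1 + \<sigma>)) \<ge> exp (- (1 + \<sigma>) * z)"
  using assms by (simp add: powr_def mult_left_mono)

text \<open>A form of Chebyshev's upper bound. It follows by positivity from the comparison of the Fejer means
at scale \<open>l = 1\<close>.\<close>

lemma unit_mass_mangoldt: "\<exists>M. unit_mass_le (\<lambda>n. mangoldt n / real n) M"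
proof -
  obtain C where C: "C \<ge> 0" "\<forall>\<sigma> y. 0 < \<sigma> \<longrightarrow> \<sigma> \<le> 1 \<longrightarrow> y > 0 \<longrightarrow>
    \<bar>fejer_mean mangoldt 1 \<sigma> y - fejer_mean (\<lambda>_. 1) 1 \<sigma> y\<bar> \<le> C / y"
    using fejer_mean_diff[of 1] by auto
  define M where "M = 12 * (57 + C)"
  have "sum (\<lambda>n. mangoldt n / real n) A \<le> M" if A: "finite A" "\<forall>n\<in>A. n \<ge> 1 \<and> log_block n = j" for j A
  proof -
    define y where "y = real j + 1"
    \<comment> \<open>With this \<open>\<sigma>\<close>, on the block \<open>n powr (-\<sigma>) \<ge> exp (-1) \<ge> 1 / 3\<close>, and the kernel is at least \<open>1 / 4\<close>.\<close>
    define \<sigma> where "\<sigma> = 1 / y"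
    have y: "y \<ge> 1" by (simp add: y_def)
    have \<sigma>: "0 < \<sigma>" "\<sigma> \<le> 1" using y by (auto simp: \<sigma>_def)
    have "sum (\<lambda>n. mangoldt n / real n) A \<le> 
          (\<Sum>n\<in>A. 12 * (mangoldt n * real n powr (-(1 + \<sigma>)) * fejer (1 * (ln (real n) - y))))"
    proof (rule sum_mono)
      fix n assume "n \<in> A"
      hence n: "n \<ge> 1" "log_block n = j" using A by auto
      have lb: "real j \<le> ln (real n)" "ln (real n) < y"
        using log_block_bounds[OF n(1)] n by (auto simp: y_def)
      have "1 / 4 \<le> fejer (1 * (ln (real n) - y))"
        using lb by (intro fejer_ge_quarter) (auto simp: y_def)
      moreover have "1 / 3 \<le> real n powr (- \<sigma>)"
      proof -
        have "\<sigma> * ln (real n) \<le> 1" using lb y by (simp add: \<sigma>_def)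
        hence "exp (-1) \<le> real n powr (- \<sigma>)" using n by (simp add: powr_def)
        moreover have "1 / 3 \<le> exp (-1 :: real)"
          using exp_le by (simp add: exp_minus field_simps)
        ultimately show ?thesis by linarith
      qed
      ultimately have "(1 / 3) * (1 / 4) \<le> real n powr (- \<sigma>) * fejer (1 * (ln (real n) - y))"
        by (intro mult_mono) auto
      hence "(mangoldt n / real n) * 1 \<le> (mangoldt n / real n) * 
               (12 * (real n powr (- \<sigma>) * fejer (1 * (ln (real n) - y))))"
        by (intro mult_left_mono divide_nonneg_nonneg mangoldt_nonneg) auto
      thus "mangoldt n / real n \<le> 12 * (mangoldt n * real n powr (-(1 + \<sigma>)) * fejer (1 * (ln (real n) - y)))"
        unfolding powr_shift by (simp add: mult_ac)
    qed
    also have "\<dots> = 12 * (\<Sum>n\<in>A. mangoldt n * real n powr (-(1 + \<sigma>)) * fejer (1 * (ln (real n) - y)))"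
      by (simp only: sum_distrib_left)
    also have "\<dots> \<le> 12 * fejer_mean mangoldt 1 \<sigma> y"
      unfolding fejer_mean_def using fejer_nonneg mangoldt_nonneg \<sigma>
      by (intro mult_left_mono sum_le_suminf summable_fejer_mangoldt A) auto
    also have "fejer_mean mangoldt 1 \<sigma> y \<le> fejer_mean (\<lambda>_. 1) 1 \<sigma> y + C / y"
      using C(2)[rule_format, of \<sigma> y] \<sigma> y by linarith
    also have "fejer_mean (\<lambda>_. 1) 1 \<sigma> y \<le> 57"
      using fejer_mean_one_le[of 1 \<sigma> y] \<sigma> y by simp
    also have "C / y \<le> C" using C(1) y by (simp add: divide_le_eq mult_le_cancel_left1)
    finally show ?thesis by (simp add: M_def)
  qed
  moreover have "M \<ge> 0" using C by (simp add: M_def)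
  ultimately have "unit_mass_le (\<lambda>n. mangoldt n / real n) M"
    using mangoldt_nonneg unfolding unit_mass_le_def by auto
  thus ?thesis by blast
qed

section \<open>Primes in short intervals\<close>

text \<open>Proper prime powers contribute negligibly: those up to \<open>exp (y + 1)\<close> have a base of at most
\<open>exp ((y + 1) / 2)\<close> and an exponent of at most \<open>2 * (y + 1)\<close>.\<close>

lemma mangoldt_proper_powers_le:
  assumes y: "y \<ge> 1" and A: "finite A" "\<And>n. n \<in> A \<Longrightarrow> n \<ge> 1 \<and> \<bar>ln (real n) - y\<bar> \<le> 1 \<and> \<not> prime n"
  shows "(\<Sum>n\<in>A. mangoldt n / real n) \<le> (y + 1) * exp (1 - y) * (exp ((y + 1) / 2) * (2 * (y + 1)))"
proof -
  define A' where "A' = {n\<in>A. primepow n}"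
  have "(\<Sum>n\<in>A. mangoldt n / real n) = (\<Sum>n\<in>A'. mangoldt n / real n)"
    using A(1) by (intro sum.mono_neutral_right) (auto simp: A'_def mangoldt_def)
  also have "\<dots> \<le> (\<Sum>n\<in>A'. (y + 1) * exp (1 - y))"
  proof (rule sum_mono)
    fix n assume "n \<in> A'"
    hence n: "n \<ge> 1" "\<bar>ln (real n) - y\<bar> \<le> 1" using A(2) by (auto simp: A'_def)
    have "mangoldt n \<le> ln (real n)" using n by (intro mangoldt_le) auto
    also have "\<dots> \<le> y + 1" using n by linarith
    finally have "mangoldt n \<le> y + 1" .
    moreover have "inverse (real n) \<le> exp (1 - y)"
    proof -
      have "exp (- ln (real n)) \<le> exp (1 - y)" using n by simp
      thus ?thesis using n by (simp add: exp_minus)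
    qed
    ultimately have "mangoldt n * inverse (real n) \<le> (y + 1) * exp (1 - y)"
      using y by (intro mult_mono mangoldt_nonneg) auto
    thus "mangoldt n / real n \<le> (y + 1) * exp (1 - y)" by (simp add: divide_inverse)
  qed
  also have "\<dots> = (y + 1) * exp (1 - y) * real (card A')" by simp
  also have "real (card A') \<le> exp ((y + 1) / 2) * (2 * (y + 1))"
  proof -
    define P where "P = {1..nat \<lfloor>exp ((y + 1) / 2)\<rfloor>}"
    define K where "K = {1..nat \<lfloor>2 * (y + 1)\<rfloor>}"
    have "A' \<subseteq> (\<lambda>(p, k). p ^ k) ` (P \<times> K)"
    proof
      fix n assume n: "n \<in> A'"
      hence n1: "n \<ge> 1" "ln (real n) \<le> y + 1" "\<not> prime n" using A(2)[of n] by (auto simp: A'_def)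
      from n have "primepow n" by (simp add: A'_def)
      then obtain p k where pk: "prime p" "k > 0" "n = p ^ k" by (auto simp: primepow_def)
      have p2: "p \<ge> 2" using pk(1) prime_ge_2_nat by blast
      have k2: "k \<ge> 2"
      proof (rule ccontr)
        assume "\<not> k \<ge> 2"
        hence "k = 1" using pk(2) by simp
        thus False using pk n1 by simp
      qed
      have ln: "real k * ln (real p) \<le> y + 1" using n1(2) p2 unfolding pk(3) by (simp add: ln_realpow)
      have lnp: "ln (real p) \<ge> 1 / 2"
      proof -
        have "ln 2 \<le> ln (real p)" using p2 by simp
        thus ?thesis using ln2_ge_two_thirds by linarith
      qed
      have "2 * ln (real p) \<le> real k * ln (real p)" using k2 lnp by (intro mult_right_mono) auto
      hence "ln (real p) \<le> (y + 1) / 2" using ln by simp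
      hence "real p \<le> exp ((y + 1) / 2)" using p2 by (metis exp_le_cancel_iff exp_ln of_nat_0_less_iff pos2 less_le_trans)
      hence "p \<in> P" using p2 unfolding P_def by (simp add: le_nat_floor)
      moreover have "real k * (1 / 2) \<le> real k * ln (real p)" using lnp by (intro mult_left_mono) auto
      hence "real k \<le> 2 * (y + 1)" using ln by simp
      hence "k \<in> K" using k2 le_nat_floor[of k "2 * (y + 1)"] unfolding K_def by simp
      ultimately show "n \<in> (\<lambda>(p, k). p ^ k) ` (P \<times> K)" using pk(3) by auto
    qed
    hence "card A' \<le> card ((\<lambda>(p, k). p ^ k) ` (P \<times> K))" by (intro card_mono) (auto simp: P_def K_def)
    also have "\<dots> \<le> card (P \<times> K)" by (intro card_image_le) (auto simp: P_def K_def)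
    also have "\<dots> = nat \<lfloor>exp ((y + 1) / 2)\<rfloor> * nat \<lfloor>2 * (y + 1)\<rfloor>"
      by (simp add: P_def K_def)
    finally have "real (card A') \<le> real (nat \<lfloor>exp ((y + 1) / 2)\<rfloor>) * real (nat \<lfloor>2 * (y + 1)\<rfloor>)"
      unfolding of_nat_mult[symmetric] by (rule of_nat_mono)
    also have "\<dots> \<le> exp ((y + 1) / 2) * (2 * (y + 1))"
      using y by (intro mult_mono of_nat_floor) auto
    finally show ?thesis .
  qed
  finally show ?thesis using y by (simp add: mult_left_mono)
qed

text \<open>The Fejer mean of the constant weight is at least of order \<open>1 / l\<close>: already the integers between
\<open>exp y\<close> and \<open>exp (y + 1 / l)\<close> suffice.\<close>

lemma fejer_mean_one_ge:
  assumes l: "l \<ge> 1" and y: "y > 0"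
  shows "fejer_mean (\<lambda>_. 1) l (1 / (y + 1)) y \<ge> exp (-2) / (4 * l) - exp (- y - 2) / 4"
proof -
  define \<sigma> where "\<sigma> = 1 / (y + 1)"
  have \<sigma>: "\<sigma> > 0" "(1 + \<sigma>) * (y + 1) = y + 2" using y by (auto simp: \<sigma>_def field_simps)
  define I where "I = {nat \<lfloor>exp y\<rfloor><..nat \<lfloor>exp (y + 1 / l)\<rfloor>}"
  have I: "exp y < real n" "real n \<le> exp (y + 1 / l)" "n \<ge> 1" if "n \<in> I" for n
  proof -
    have n: "nat \<lfloor>exp y\<rfloor> < n" "n \<le> nat \<lfloor>exp (y + 1 / l)\<rfloor>" using that by (auto simp: I_def)
    show "exp y < real n" using n(1) by linarith
    show "real n \<le> exp (y + 1 / l)" using n(2) exp_gt_zero[of "y + 1 / l"] by linarith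
    show "n \<ge> 1" using n(1) by linarith
  qed
  have "exp y / l - 1 \<le> real (card I)"
  proof -
    have "exp y * (1 + 1 / l) \<le> exp y * exp (1 / l)"
      by (intro mult_left_mono exp_ge_add_one_self) auto
    hence "exp y / l \<le> exp (y + 1 / l) - exp y" by (simp add: exp_add algebra_simps)
    moreover have "nat \<lfloor>exp y\<rfloor> \<le> nat \<lfloor>exp (y + 1 / l)\<rfloor>"
      using l by (intro nat_mono floor_mono) auto
    hence "real (card I) = real (nat \<lfloor>exp (y + 1 / l)\<rfloor>) - real (nat \<lfloor>exp y\<rfloor>)" by (simp add: I_def)
    moreover have "real (nat \<lfloor>exp (y + 1 / l)\<rfloor>) > exp (y + 1 / l) - 1" by linarith
    moreover have "real (nat \<lfloor>exp y\<rfloor>) \<le> exp y" by (intro of_nat_floor) auto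
    ultimately show ?thesis by linarith
  qed
  hence "(exp y / l - 1) * (exp (- y - 2) / 4) \<le> real (card I) * (exp (- y - 2) / 4)"
    by (intro mult_right_mono) auto
  also have "\<dots> = (\<Sum>n\<in>I. exp (- y - 2) * (1 / 4))" by simp
  also have "\<dots> \<le> (\<Sum>n\<in>I. 1 * real n powr (-(1 + \<sigma>)) * fejer (l * (ln (real n) - y)))"
  proof (rule sum_mono)
    fix n assume n: "n \<in> I"
    have n0: "real n > 0" using I(3)[OF n] by simp
    have "ln (exp y) < ln (real n)" using I(1)[OF n] n0 by (subst ln_less_cancel_iff) auto
    hence l1: "y < ln (real n)" by simp
    have "ln (real n) \<le> ln (exp (y + 1 / l))" using I(2)[OF n] n0 by (subst ln_le_cancel_iff) auto
    hence l2: "ln (real n) \<le> y + 1 / l" by simp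
    have l3: "1 / l \<le> 1" using l by simp
    have "exp (- (1 + \<sigma>) * (y + 1)) \<le> real n powr (-(1 + \<sigma>))"
      using l2 l3 \<sigma> I[OF n] by (intro powr_neg_ge) auto
    also have "- (1 + \<sigma>) * (y + 1) = - y - 2" unfolding mult_minus_left \<sigma>(2) by simp
    finally have e: "exp (- y - 2) \<le> real n powr (-(1 + \<sigma>))" .
    have "l * (ln (real n) - y) \<le> l * (1 / l)" using l l2 by (intro mult_left_mono) auto
    hence "1 / 4 \<le> fejer (l * (ln (real n) - y))"
      using l l1 by (intro fejer_ge_quarter) (simp add: abs_mult)
    with e show "exp (- y - 2) * (1 / 4) \<le> 1 * real n powr (-(1 + \<sigma>)) * fejer (l * (ln (real n) - y))"
      unfolding mult_1_left by (intro mult_mono) auto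
  qed
  also have "\<dots> \<le> fejer_mean (\<lambda>_. 1) l \<sigma> y"
    unfolding fejer_mean_def using fejer_nonneg \<sigma>(1)
    by (intro sum_le_suminf summable_fejer_one) (auto simp: I_def)
  also have "(exp y / l - 1) * (exp (- y - 2) / 4) = exp (-2) / (4 * l) - exp (- y - 2) / 4"
  proof -
    have "exp y * exp (- y - 2) = exp (-2 :: real)" by (simp flip: exp_add)
    thus ?thesis using l by (simp add: field_simps)
  qed
  finally show ?thesis by (simp add: \<sigma>_def)
qed

text \<open>If there are no primes in the window of radius \<open>\<delta>\<close> around \<open>y\<close>, then apart from proper prime powers
only the tails of the kernel count, and these are of order \<open>1 / l\<^sup>2\<close>.\<close>

lemma fejer_mean_mangoldt_le:
  assumes M: "unit_mass_le (\<lambda>n. mangoldt n / real n) M"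
    and l: "l > 0" and \<delta>: "\<delta> > 0" "\<delta> \<le> 1" and y: "y \<ge> 1" and \<sigma>: "\<sigma> > 0"
    and np: "\<And>p. prime p \<Longrightarrow> \<bar>ln (real p) - y\<bar> > \<delta>"
  shows "fejer_mean mangoldt l \<sigma> y \<le> 
    (y + 1) * exp (1 - y) * (exp ((y + 1) / 2) * (2 * (y + 1))) + (12 * M / \<delta>\<^sup>2 + 16 * M) / l\<^sup>2"
  unfolding fejer_mean_def
proof (rule suminf_le_const[OF summable_fejer_mangoldt[OF \<sigma>]])
  fix N
  define f where "f n = mangoldt n * real n powr (-(1 + \<sigma>)) * fejer (l * (ln (real n) - y))" for n
  define A1 where "A1 = {n\<in>{1..<N}. \<bar>ln (real n) - y\<bar> \<le> \<delta>}"
  define A2 where "A2 = {n\<in>{1..<N}. \<bar>ln (real n) - y\<bar> > \<delta>}"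
  have "sum f {..<N} = sum f {1..<N}"
    by (rule sum.mono_neutral_right) (auto simp: Suc_le_eq f_def)
  also have "\<dots> = sum f A1 + sum f A2"
    by (subst sum.union_disjoint[symmetric]) (auto simp: A1_def A2_def intro!: sum.cong)
  also have "sum f A1 \<le> (y + 1) * exp (1 - y) * (exp ((y + 1) / 2) * (2 * (y + 1)))"
  proof -
    have "sum f A1 \<le> (\<Sum>n\<in>A1. mangoldt n / real n)"
    proof (rule sum_mono)
      fix n
      have "real n powr (- \<sigma>) * fejer (l * (ln (real n) - y)) \<le> 1 * 1"
        using \<sigma> powr_mono[of "- \<sigma>" 0 "real n"] fejer_nonneg
        by (intro mult_mono fejer_le_1) (cases "n = 0"; auto)+
      hence "mangoldt n / real n * (real n powr (- \<sigma>) * fejer (l * (ln (real n) - y))) \<le> mangoldt n / real n * (1 * 1)"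
        by (intro mult_left_mono divide_nonneg_nonneg mangoldt_nonneg) auto
      thus "f n \<le> mangoldt n / real n" unfolding f_def powr_shift by (simp add: mult_ac)
    qed
    also have "\<dots> \<le> (y + 1) * exp (1 - y) * (exp ((y + 1) / 2) * (2 * (y + 1)))"
    proof (rule mangoldt_proper_powers_le[OF y])
      show "finite A1" by (simp add: A1_def)
      show "n \<ge> 1 \<and> \<bar>ln (real n) - y\<bar> \<le> 1 \<and> \<not> prime n" if "n \<in> A1" for n
        using np[of n] that \<delta> by (auto simp: A1_def)
    qed
    finally show ?thesis .
  qed
  also have "sum f A2 \<le> 3 * M * (4 / (l * \<delta>)\<^sup>2) + 16 * M / l\<^sup>2"
    unfolding f_def
  proof (rule fejer_mean_le)
    show "unit_mass_le (\<lambda>n. mangoldt n * real n powr (-(1 + \<sigma>))) M"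
      using \<sigma> M by (intro unit_mass_powr mangoldt_nonneg) auto
    fix n assume n: "n \<in> A2"
    define u where "u = ln (real n) - y"
    have u: "\<bar>u\<bar> > \<delta>" using n by (simp add: A2_def u_def)
    hence u0: "u \<noteq> 0" using \<delta> by auto
    have "fejer (l * u) \<le> 4 / (l * u)\<^sup>2" using u0 l by (intro fejer_le) auto
    also have "\<dots> \<le> 4 / (l * \<delta>)\<^sup>2"
    proof (rule divide_left_mono)
      have "\<delta>\<^sup>2 \<le> \<bar>u\<bar>\<^sup>2" using u \<delta> by (intro power_mono) auto
      thus "(l * \<delta>)\<^sup>2 \<le> (l * u)\<^sup>2" by (simp add: power_mult_distrib mult_left_mono)
      show "0 < (l * u)\<^sup>2 * (l * \<delta>)\<^sup>2" using u0 l \<delta> by simp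
    qed simp
    finally show "fejer (l * (ln (real n) - y)) \<le> 4 / (l * \<delta>)\<^sup>2" by (simp add: u_def)
  qed (use l y in \<open>auto simp: A2_def\<close>)
  also have "3 * M * (4 / (l * \<delta>)\<^sup>2) + 16 * M / l\<^sup>2 = (12 * M / \<delta>\<^sup>2 + 16 * M) / l\<^sup>2"
    using l \<delta> by (simp add: field_simps power_mult_distrib)
  finally show "(\<Sum>n<N. mangoldt n * real n powr (-(1 + \<sigma>)) * fejer (l * (ln (real n) - y))) \<le>
     (y + 1) * exp (1 - y) * (exp ((y + 1) / 2) * (2 * (y + 1))) + (12 * M / \<delta>\<^sup>2 + 16 * M) / l\<^sup>2"
    unfolding f_def by simp
qed

text \<open>The lower bound of order \<open>1 / l\<close> and the upper bound of order \<open>1 / l\<^sup>2\<close> contradict each other once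
the fixed \<open>l\<close> is large and then \<open>y\<close> is large.\<close>

lemma prime_in_log_window:
  assumes \<delta>: "\<delta> > 0" "\<delta> \<le> 1"
  shows "\<forall>\<^sub>F y in at_top. \<exists>p. prime p \<and> \<bar>ln (real p) - y\<bar> \<le> \<delta>"
proof -
  obtain M where M: "unit_mass_le (\<lambda>n. mangoldt n / real n) M" using unit_mass_mangoldt by blast
  have M0: "M \<ge> 0" using M by (simp add: unit_mass_le_def)
  define Q where "Q = 12 * M / \<delta>\<^sup>2 + 16 * M"
  have Q: "Q \<ge> 0" using M0 by (simp add: Q_def)
  define c :: real where "c = exp (-2) / 4"
  have c: "c > 0" by (simp add: c_def)
  \<comment> \<open>Chosen so that the tail bound \<open>Q / l\<^sup>2\<close> is at most half of the main term \<open>c / l\<close>.\<close>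
  define l where "l = 1 + 2 * Q / c"
  have l: "l \<ge> 1" using Q c by (simp add: l_def)
  have "2 * Q \<le> c * l" using c by (simp add: l_def field_simps)
  hence "2 * Q * (1 / l\<^sup>2) \<le> c * l * (1 / l\<^sup>2)" by (intro mult_right_mono) auto
  hence Ql: "Q / l\<^sup>2 \<le> c / (2 * l)" using l by (simp add: field_simps power2_eq_square)
  obtain C where C: "\<forall>\<sigma> y. 0 < \<sigma> \<longrightarrow> \<sigma> \<le> 1 \<longrightarrow> y > 0 \<longrightarrow>
    \<bar>fejer_mean mangoldt l \<sigma> y - fejer_mean (\<lambda>_. 1) l \<sigma> y\<bar> \<le> C / y"
    using fejer_mean_diff[of l] l by auto
  have "((\<lambda>y::real. exp (- y - 2) / 4 + (y + 1) * exp (1 - y) * (exp ((y + 1) / 2) * (2 * (y + 1))) + C / y) \<longlongrightarrow> 0) at_top"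
    by real_asymp
  moreover have "c / (2 * l) > 0" using c l by simp
  ultimately have "\<forall>\<^sub>F y in at_top. exp (- y - 2) / 4 + (y + 1) * exp (1 - y) * (exp ((y + 1) / 2) * (2 * (y + 1))) + C / y < c / (2 * l)"
    by (rule order_tendstoD(2))
  thus ?thesis using eventually_ge_at_top[of 1]
  proof eventually_elim
    case (elim y)
    show ?case
    proof (rule ccontr)
      assume "\<not> (\<exists>p. prime p \<and> \<bar>ln (real p) - y\<bar> \<le> \<delta>)"
      hence np: "\<And>p. prime p \<Longrightarrow> \<bar>ln (real p) - y\<bar> > \<delta>" by (meson not_le)
      define \<sigma> where "\<sigma> = 1 / (y + 1)"
      have \<sigma>: "0 < \<sigma>" "\<sigma> \<le> 1" using elim by (auto simp: \<sigma>_def)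
      have "c / l - exp (- y - 2) / 4 \<le> fejer_mean (\<lambda>_. 1) l \<sigma> y"
        using fejer_mean_one_ge[of l y] l elim by (simp add: c_def \<sigma>_def)
      also have "\<dots> \<le> fejer_mean mangoldt l \<sigma> y + C / y"
        using C[rule_format, of \<sigma> y] \<sigma> elim by linarith
      also have "fejer_mean mangoldt l \<sigma> y \<le> (y + 1) * exp (1 - y) * (exp ((y + 1) / 2) * (2 * (y + 1))) + Q / l\<^sup>2"
        unfolding Q_def using l elim by (intro fejer_mean_mangoldt_le M \<delta> \<sigma> np) auto
      finally have "c / l \<le> exp (- y - 2) / 4 + (y + 1) * exp (1 - y) * (exp ((y + 1) / 2) * (2 * (y + 1))) + C / y + c / (2 * l)"
        using Ql by linarith
      also have "\<dots> < c / (2 * l) + c / (2 * l)" using elim by linarith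
      also have "\<dots> = c / l" using l by (simp add: field_simps)
      finally show False by simp
    qed
  qed
qed

lemma prime_just_below:
  assumes "\<epsilon> > 0"
  shows "\<forall>\<^sub>F x in at_top. \<exists>p. prime p \<and> real p \<le> x \<and> (1 - \<epsilon>) * x \<le> real p - 1"
proof -
  \<comment> \<open>The window of radius \<open>\<delta>\<close> around \<open>ln x - \<delta>\<close> lies below \<open>ln x\<close>.\<close>
  define \<delta> where "\<delta> = min 1 (\<epsilon> / 4)"
  have \<delta>: "\<delta> > 0" "\<delta> \<le> 1" "2 * \<delta> \<le> \<epsilon> / 2" using assms by (auto simp: \<delta>_def)
  have "\<forall>\<^sub>F x in at_top. \<exists>p. prime p \<and> \<bar>ln (real p) - (ln x - \<delta>)\<bar> \<le> \<delta>"
  proof (rule eventually_compose_filterlim[OF prime_in_log_window[OF \<delta>(1,2)]])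
    show "filterlim (\<lambda>x. ln x - \<delta>) at_top at_top" by real_asymp
  qed
  thus ?thesis using eventually_ge_at_top[of "max 1 (2 / \<epsilon>)"]
  proof eventually_elim
    case (elim x)
    then obtain p where p: "prime p" "\<bar>ln (real p) - (ln x - \<delta>)\<bar> \<le> \<delta>" by blast
    have x: "x \<ge> 1" "x \<ge> 2 / \<epsilon>" using elim by auto
    have p0: "real p > 0" using prime_gt_0_nat[OF p(1)] by simp
    have "ln (real p) \<le> ln x" using p(2) by linarith
    hence "real p \<le> x" using p0 x by simp
    moreover have "(1 - \<epsilon>) * x \<le> real p - 1"
    proof -
      have "ln x - 2 * \<delta> \<le> ln (real p)" using p(2) by linarith
      hence "exp (ln x - 2 * \<delta>) \<le> real p" using p0 by (metis exp_le_cancel_iff exp_ln)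
      moreover have "exp (ln x - 2 * \<delta>) = x * exp (- (2 * \<delta>))" using x by (simp add: exp_diff exp_minus field_simps)
      moreover have "x * (1 - \<epsilon> / 2) \<le> x * exp (- (2 * \<delta>))"
        using x \<delta>(3) exp_ge_add_one_self[of "- (2 * \<delta>)"] by (intro mult_left_mono) auto
      moreover have "x * \<epsilon> / 2 \<ge> 1" using x(2) assms by (simp add: field_simps)
      ultimately show ?thesis by (simp add: algebra_simps)
    qed
    ultimately show ?case using p(1) by blast
  qed
qed

section \<open>Lower bounds for generalized Sidon sets\<close>

text \<open>The prime \<open>p\<close> for the modulus is taken just below \<open>sqrt (n / N)\<close>, so that \<open>p * (p - 1) * N \<le> n\<close> and the set has about \<open>length as * sqrt (n / N)\<close> elements.\<close>

lemma sidon_sigma_ge: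
  assumes A: "reps_bounded h N as" and h: "h > 0" and N: "N > 0"
  shows "sidon_sigma (2 * h) \<ge> ereal (sqrt ((real (length as))\<^sup>2 / (real h * real N)))"
proof -
  define V where "V = real (length as) / sqrt (real h * real N)"
  have hN: "real h > 0" "real N > 0" using h N by auto
  have bound: "ereal ((1 - \<epsilon>) * V) \<le> sidon_sigma (2 * h)" if \<epsilon>: "\<epsilon> > 0" for \<epsilon>
    unfolding sidon_sigma_def
  proof (rule Liminf_bounded)
    have "filterlim (\<lambda>n. sqrt (real n / real N)) at_top sequentially"
      using hN by real_asymp
    from eventually_compose_filterlim[OF prime_just_below[OF \<epsilon>] this]
    have "\<forall>\<^sub>F n in sequentially. \<exists>p. prime p \<and> real p \<le> sqrt (real n / real N) \<and>
            (1 - \<epsilon>) * sqrt (real n / real N) \<le> real p - 1" .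
    thus "\<forall>\<^sub>F n in sequentially. ereal ((1 - \<epsilon>) * V) \<le> 
            ereal (real (R_max (2 * h) n) / sqrt (real (2 * h div 2) * real n))"
      using eventually_gt_at_top[of 0]
    proof eventually_elim
      case (elim n)
      then obtain p where p: "prime p" "real p \<le> sqrt (real n / real N)"
        "(1 - \<epsilon>) * sqrt (real n / real N) \<le> real p - 1" by blast
      have p2: "p \<ge> 2" using p(1) by (rule prime_ge_2_nat)
      obtain S where S: "modular_sidon (p * (p - 1)) S" "card S = p - 1"
        using ruzsa_sidon[OF p(1)] by blast
      have "(real p)\<^sup>2 \<le> (sqrt (real n / real N))\<^sup>2" using p(2) by (intro power_mono) auto
      hence "real p * real p * real N \<le> real n" using hN by (simp add: field_simps power2_eq_square)
      hence "real (p * p * N) \<le> real n" by simp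
      hence "p * p * N \<le> n" by (simp only: of_nat_le_iff)
      moreover have "p * (p - 1) * N \<le> p * p * N" by (intro mult_right_mono mult_left_mono) auto
      ultimately have "p * (p - 1) * N \<le> n" by linarith
      from interleave_bound[OF S(1) reps_boundedD(1)[OF A] reps_boundedD(3)[OF A] this]
      have "(p - 1) * length as \<le> R_max (2 * h) n" by (simp only: S(2) reps_boundedD(2)[OF A])
      hence "real ((p - 1) * length as) \<le> real (R_max (2 * h) n)" by (rule of_nat_mono)
      hence R: "(real p - 1) * real (length as) \<le> real (R_max (2 * h) n)" using p2 by (simp add: of_nat_diff)
      have "(1 - \<epsilon>) * sqrt (real n / real N) * real (length as) \<le> (real p - 1) * real (length as)"
        using p(3) by (intro mult_right_mono) auto
      hence "(1 - \<epsilon>) * sqrt (real n / real N) * real (length as) / sqrt (real h * real n) \<le>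
             real (R_max (2 * h) n) / sqrt (real h * real n)"
        using R by (intro divide_right_mono) auto
      also have "(1 - \<epsilon>) * sqrt (real n / real N) * real (length as) / sqrt (real h * real n) = (1 - \<epsilon>) * V"
        using elim hN by (simp add: V_def real_sqrt_mult real_sqrt_divide field_simps)
      finally show ?case by simp
    qed
  qed
  have "(\<lambda>k. (1 - 1 / real (Suc k)) * V) \<longlonglongrightarrow> V" by real_asymp
  hence "(\<lambda>k. ereal ((1 - 1 / real (Suc k)) * V)) \<longlonglongrightarrow> ereal V" by simp
  hence "ereal V \<le> sidon_sigma (2 * h)"
    by (rule LIMSEQ_le_const2) (use bound in auto)
  also have "V = sqrt ((real (length as))\<^sup>2 / (real h * real N))"
    by (simp add: V_def real_sqrt_divide)
  finally show ?thesis .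
qed

text \<open>The dense blocks \<open>as\<close> used for interleaving. Each is a set of \<open>length as\<close> integers in
\<open>{0, ..., N - 1}\<close> in which every integer has at most \<open>h\<close> ordered representations as a sum of two.\<close>

lemma reps_bounded_examples:
  "reps_bounded 2 7 [0,2,5,6]"
  "reps_bounded 3 5 [0,2,3,4]"
  "reps_bounded 4 14 [0,1,2,6,8,9,11,13]"
  "reps_bounded 5 9 [0,1,2,3,4,7,8]"
  "reps_bounded 6 20 [0,1,2,3,4,5,8,9,12,14,18,19]"
  "reps_bounded 7 15 [0,2,3,4,5,6,7,8,12,13,14]"
  "reps_bounded 8 30 [0,1,2,3,4,12,14,16,17,18,19,21,22,23,25,28,29]"
  "reps_bounded 9 24 [0,1,2,7,9,10,11,15,16,17,18,19,20,21,22,23]"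
  "reps_bounded 10 33 [0,1,2,3,10,11,12,13,18,20,22,23,24,25,26,27,28,29,31,32]"
  "reps_bounded 11 25 [0,1,2,3,4,9,12,13,14,15,16,17,18,19,20,22,23,24]"
  by code_simp+

theorem theorem3:
  shows "sidon_sigma 4 \<ge> ereal (sqrt (8 / 7)) \<and> sqrt (8 / 7) > (1.069 :: real)
   \<and> sidon_sigma 6 \<ge> ereal (sqrt (16 / 15)) \<and> sqrt (16 / 15) > (1.032 :: real)
   \<and> sidon_sigma 8 \<ge> ereal (sqrt (8 / 7)) \<and> sqrt (8 / 7) > (1.069 :: real)
   \<and> sidon_sigma 10 \<ge> ereal (sqrt (49 / 45)) \<and> sqrt (49 / 45) > (1.043 :: real)
   \<and> sidon_sigma 12 \<ge> ereal (sqrt (6 / 5)) \<and> sqrt (6 / 5) > (1.095 :: real)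
   \<and> sidon_sigma 14 \<ge> ereal (sqrt (121 / 105)) \<and> sqrt (121 / 105) > (1.073 :: real)
   \<and> sidon_sigma 16 \<ge> ereal (sqrt (289 / 240)) \<and> sqrt (289 / 240) > (1.097 :: real)
   \<and> sidon_sigma 18 \<ge> ereal (sqrt (32 / 27)) \<and> sqrt (32 / 27) > (1.088 :: real)
   \<and> sidon_sigma 20 \<ge> ereal (sqrt (40 / 33)) \<and> sqrt (40 / 33) > (1.100 :: real)
   \<and> sidon_sigma 22 \<ge> ereal (sqrt (324 / 275)) \<and> sqrt (324 / 275) > (1.085 :: real)"
proof -
  note b = reps_bounded_examples
  have "sidon_sigma 4 \<ge> ereal (sqrt (8 / 7))" using sidon_sigma_ge[OF b(1)] by simp
  moreover have "sidon_sigma 6 \<ge> ereal (sqrt (16 / 15))" using sidon_sigma_ge[OF b(2)] by simp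
  moreover have "sidon_sigma 8 \<ge> ereal (sqrt (8 / 7))" using sidon_sigma_ge[OF b(3)] by simp
  moreover have "sidon_sigma 10 \<ge> ereal (sqrt (49 / 45))" using sidon_sigma_ge[OF b(4)] by simp
  moreover have "sidon_sigma 12 \<ge> ereal (sqrt (6 / 5))" using sidon_sigma_ge[OF b(5)] by simp
  moreover have "sidon_sigma 14 \<ge> ereal (sqrt (121 / 105))" using sidon_sigma_ge[OF b(6)] by simp
  moreover have "sidon_sigma 16 \<ge> ereal (sqrt (289 / 240))" using sidon_sigma_ge[OF b(7)] by simp
  moreover have "sidon_sigma 18 \<ge> ereal (sqrt (32 / 27))" using sidon_sigma_ge[OF b(8)] by simp
  moreover have "sidon_sigma 20 \<ge> ereal (sqrt (40 / 33))" using sidon_sigma_ge[OF b(9)] by simp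
  moreover have "sidon_sigma 22 \<ge> ereal (sqrt (324 / 275))" using sidon_sigma_ge[OF b(10)] by simp
  moreover have "sqrt (8 / 7) > (1.069 :: real)" "sqrt (16 / 15) > (1.032 :: real)"
    "sqrt (49 / 45) > (1.043 :: real)" "sqrt (6 / 5) > (1.095 :: real)" "sqrt (121 / 105) > (1.073 :: real)"
    "sqrt (289 / 240) > (1.097 :: real)" "sqrt (32 / 27) > (1.088 :: real)" "sqrt (40 / 33) > (1.100 :: real)"
    "sqrt (324 / 275) > (1.085 :: real)"
    by (rule real_less_rsqrt, simp add: power2_eq_square)+
  ultimately show ?thesis by blast
qed

end
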